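(* Suppose that $\|f_0-f_\lambda\|_\infty$ is bounded above uniformly in $\lambda$ ($f_0$ need not belong to $H$). Fix $n$, $\lambda>0$, $\eta\in(0,1)$ and suppose: (i) there exists a Gaussian random element $Z$ in $H$ with covariance $\Sigma$ such that with probability at least $1-\eta$, $\|\sqrt n(\hat f-f_\lambda)-Z\|\le Q=Q(n,\lambda,\eta)$; (ii) there exists a random element $Z'$ in $H$ whose conditional distribution given $D$ is almost surely Gaussian with covariance $\Sigma$, and with probability at least $1-\eta$, $\mathbb P\{\|\mathfrak B-Z'\|\le R\mid D\}\ge1-\eta$, $R=R(n,\lambda,\eta)$; (iii) for every $\eta'\in(0,1)$, with probability at least $1-\eta'$, $\|Z\|\ge L(\lambda,\eta')$, with $L$ strictly increasing in its second argument. Let $\Delta=Q+R$. Then: (1) Let $\alpha\in(0,1)$, define $\hat t_\alpha$ by $\mathbb P(\|\mathfrak B\|>\hat t_\alpha\mid D)=\alpha$, and suppose $\eta<\min(\alpha,\frac{1-\alpha}2)$ and $\frac12\ge\delta\ge\frac{\Delta}{L(\lambda,1-\alpha-2\eta)-\Delta}$ with positive denominator. Then $\hat C_\alpha=\{\hat f+\hat t_\alpha n^{-1/2}f:f\in H,\|f\|\le1+\delta\}$ satisfies $\mathbb P(f_\lambda\in\hat C_\alpha)\ge1-\alpha-3\eta$ and $\mathbb P\{f_\lambda\in2\delta\hat f+(1-2\delta)\hat C_\alpha\}\le1-\alpha+3\eta$. (2) Let $F:H\to\mathbb R$ satisfy $|F(u)-F(v)|\le\psi(\|u-v\|)$ for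 a (nondecreasing) modulus of continuity $\psi$. If there is a nondecreasing $\mathfrak a:(0,\infty)\to[0,1]$, potentially depending on $n$ and $\lambda$, with $\mathfrak a(r)\downarrow0$ as $r\downarrow0$ and $\sup_{t}\mathbb P\{|F(Z)-t|\le r\}\le\mathfrak a(r)$ for all $r>0$, then with probability at least $1-\eta$, $$\sup_{t\in\mathbb R}\left|\mathbb P[F\{\sqrt n(\hat f-f_\lambda)\}\le t]-\mathbb P\{F(\mathfrak B)\le t\mid D\}\right|\le\mathfrak a\{\psi(Q)\}+\mathfrak a\{\psi(R)\}+2\eta.$$ Even without the condition involving $\mathfrak a$, with probability at least $1-\eta$, $$\sup_{t\in\mathbb R}\left|\mathbb P[F\{\sqrt n(\hat f-f_\lambda)\}\le t]-\mathbb P\{F(\mathfrak B)\le t\mid D\}\right|\le2\sup_{t\in\mathbb R}\mathbb P\{|F(\mathfrak B)-t|\le2\psi(\Delta)\mid D\}+4\eta.$$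
   Context: Setting. $S$ is a Polish space and $k:S\times S\to\mathbb R$ is a positive definite kernel with $k(x,x')\le\kappa^2$. $H$ is the (separable) reproducing kernel Hilbert space of $k$, with norm $\|\cdot\|$; $k_x=k(x,\cdot)$. The data $D=\{(X_i,Y_i)\}_{i=1}^n$ are i.i.d. in $S\times\mathbb R$; $f_0(x)=\mathbb E(Y\mid X=x)$; $\varepsilon_i=Y_i-f_0(X_i)$ satisfies $|\varepsilon_i|\le\bar\sigma$ and $\mathbb E(\varepsilon_i^2\mid X_i)\ge\underline\sigma^2>0$. $\mathbb E_n(\cdot)=\frac1n\sum_{i=1}^n(\cdot)$; $u\otimes v^*:t\mapsto\langle v,t\rangle u$; $T=\mathbb E(k_X\otimes k_X^* )$, $\hat T=\mathbb E_n(k_X\otimes k_X^* )$. $\hat f=\arg\min_{f\in H}[\mathbb E_n\{Y-f(X)\}^2+\lambda\|f\|^2]$; $f_\lambda=\arg\min_{f\in H}[\mathbb E\{Y-f(X)\}^2+\lambda\|f\|^2]$ is the pseudo-true parameter. $U_i=(T+\lambda)^{-1}\{(k_{X_i}\otimes k_{X_i}^*-T)(f_0-f_\lambda)+\varepsilon_ik_{X_i}\}$, which when $f_0\notin H$ is understood as $U_i=(T+\lambda)^{-1}[\{Y_i-f_\lambda(X_i)\}k_{X_i}-\lambda f_\lambda]$ (this lies in $H$ and has mean zero), and $\Sigma=\mathbb E(U_i\otimes U_i^* )$. Bootstrap. $\hat\varepsilon_i=Y_i-\hat f(X_i)$, $\hat V_i=(\hat T+\lambda)^{-1}\hat\varepsilon_ik_{X_i}$,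 $\mathfrak B=\frac1n\sum_{i=1}^n\sum_{j=1}^n\frac{\hat V_i-\hat V_j}{\sqrt2}h_{ij}$ with $h_{ij}$ i.i.d. standard Gaussians independent of $D$. Gaussian elements are centered. *)

theory Defs
  imports "HOL-Probability.Probability"
begin

section \<open>Reproducing kernel Hilbert spaces\<close>

definition positive_definite_kernel :: "('s \<Rightarrow> 's \<Rightarrow> real) \<Rightarrow> bool" where
  "positive_definite_kernel k \<longleftrightarrow>
     (\<forall>x y. k x y = k y x) \<and>
     (\<forall>A c. finite A \<longrightarrow> 0 \<le> (\<Sum>x\<in>A. \<Sum>y\<in>A. c x * c y * k x y))"

text \<open>
  The Hilbert space is a type \<open>'h\<close>; its elements are identified with functions on \<open>'s\<close> through
  an injective linear evaluation map, so \<open>eval_at f x\<close> is the value \<open>f(x)\<close>.  The type is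
  universally quantified, and the range of \<open>eval_at\<close> carries the Hilbert structure of \<open>'h\<close>.
\<close>

definition kernel_section :: "('h \<Rightarrow> 's \<Rightarrow> real) \<Rightarrow> ('s \<Rightarrow> 's \<Rightarrow> real) \<Rightarrow> 's \<Rightarrow> 'h" where
  "kernel_section eval_at k x = inv eval_at (k x)"

definition is_rkhs ::
  "('s \<Rightarrow> 's \<Rightarrow> real) \<Rightarrow> ('h::{real_inner, banach} \<Rightarrow> 's \<Rightarrow> real) \<Rightarrow> bool" where
  "is_rkhs k eval_at \<longleftrightarrow>
     inj eval_at \<and>
     (\<forall>f g x. eval_at (f + g) x = eval_at f x + eval_at g x) \<and>
     (\<forall>c f x. eval_at (c *\<^sub>R f) x = c * eval_at f x) \<and>
     (\<forall>x. k x \<in> range eval_at) \<and>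
     (\<forall>f x. eval_at f x = inner f (kernel_section eval_at k x))"


section \<open>Operators\<close>

definition rank_one :: "'h::real_inner \<Rightarrow> 'h \<Rightarrow> 'h \<Rightarrow> 'h" where
  "rank_one u v = (\<lambda>t. inner v t *\<^sub>R u)"

text \<open>
  Expectation of a random operator, taken in the strong sense: the space of bounded operators is
  in general not separable, so the Bochner integral is applied to each \<open>A z t\<close> in \<open>'h\<close>.
\<close>

definition op_expectation ::
  "'a measure \<Rightarrow> ('a \<Rightarrow> 'h \<Rightarrow> 'h) \<Rightarrow> 'h \<Rightarrow> 'h::{banach, second_countable_topology}" where
  "op_expectation P A = (\<lambda>t. \<integral>z. A z t \<partial>P)"

definition resolvent :: "('h \<Rightarrow> 'h) \<Rightarrow> real \<Rightarrow> 'h \<Rightarrow> 'h::real_vector" where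
  "resolvent A l = inv (\<lambda>t. A t + l *\<^sub>R t)"


section \<open>Gaussian measures on a Hilbert space\<close>

definition centered_normal :: "real \<Rightarrow> real measure" where
  "centered_normal \<sigma> =
     (if \<sigma> = 0 then return borel 0 else density lborel (normal_density 0 \<sigma>))"

definition centered_gaussian ::
  "'h::{real_inner, banach, second_countable_topology} measure \<Rightarrow> bool" where
  "centered_gaussian \<mu> \<longleftrightarrow>
     prob_space \<mu> \<and> sets \<mu> = sets borel \<and>
     (\<forall>u. \<exists>\<sigma>\<ge>0. distr \<mu> borel (inner u) = centered_normal \<sigma>)"

definition has_covariance ::
  "'h::{real_inner, banach, second_countable_topology} measure \<Rightarrow> ('h \<Rightarrow> 'h) \<Rightarrow> bool" where
  "has_covariance \<mu> C \<longleftrightarrow> (\<forall>u v. (\<integral>x. inner u x * inner v x \<partial>\<mu>) = inner u (C v))"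


section \<open>Conditioning\<close>

definition data_sigma ::
  "'w measure \<Rightarrow> nat \<Rightarrow> (nat \<Rightarrow> 'w \<Rightarrow> 'd::topological_space) \<Rightarrow> 'w measure" where
  "data_sigma M n D =
     vimage_algebra (space M) (\<lambda>w. \<lambda>i\<in>{..<n}. D i w) (\<Pi>\<^sub>M i\<in>{..<n}. borel)"

text \<open>
  \<open>K\<close> is a regular version of the conditional distribution of \<open>X\<close> given \<open>G\<close>: it
  depends measurably on \<open>G\<close> and \<open>K w A\<close> is a version of the conditional probability of
  \<open>X \<in> A\<close>.  A supremum over uncountably many conditional probabilities needs such a version.
\<close>

definition regular_cond_distr ::
  "'w measure \<Rightarrow> 'w measure \<Rightarrow> 'a measure \<Rightarrow> ('w \<Rightarrow> 'a) \<Rightarrow> ('w \<Rightarrow> 'a measure) \<Rightarrow> bool" where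
  "regular_cond_distr M G N X K \<longleftrightarrow>
     X \<in> measurable M N \<and> K \<in> measurable G (prob_algebra N) \<and>
     (\<forall>A\<in>sets N. AE w in M.
        measure (K w) A = real_cond_exp M G (indicator {w' \<in> space M. X w' \<in> A}) w)"

definition with_prob_at_least :: "'w measure \<Rightarrow> real \<Rightarrow> ('w \<Rightarrow> bool) \<Rightarrow> bool" where
  "with_prob_at_least M p A \<longleftrightarrow> (\<exists>E\<in>sets M. p \<le> measure M E \<and> (\<forall>w\<in>E. A w))"


section \<open>Kernel ridge regression\<close>

text \<open>
  \<open>P\<close> is the common law of the pairs \<open>(X\<^sub>i, Y\<^sub>i)\<close>, and \<open>d i = (X\<^sub>i, Y\<^sub>i)\<close> for
  \<open>i < n\<close> is a realised sample.
\<close>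

definition pop_operator ::
  "('s \<Rightarrow> 's \<Rightarrow> real) \<Rightarrow> ('h \<Rightarrow> 's \<Rightarrow> real) \<Rightarrow> ('s \<times> real) measure
     \<Rightarrow> 'h \<Rightarrow> 'h::{real_inner, banach, second_countable_topology}" where
  "pop_operator k eval_at P =
     op_expectation P (\<lambda>z. rank_one (kernel_section eval_at k (fst z)) (kernel_section eval_at k (fst z)))"

definition emp_operator ::
  "('s \<Rightarrow> 's \<Rightarrow> real) \<Rightarrow> ('h \<Rightarrow> 's \<Rightarrow> real) \<Rightarrow> nat \<Rightarrow> (nat \<Rightarrow> 's \<times> real)
     \<Rightarrow> 'h \<Rightarrow> 'h::real_inner" where
  "emp_operator k eval_at n d =
     (\<lambda>t. (1 / real n) *\<^sub>R
        (\<Sum>i<n. rank_one (kernel_section eval_at k (fst (d i))) (kernel_section eval_at k (fst (d i))) t))"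

definition f_pseudo ::
  "('h::real_normed_vector \<Rightarrow> 's \<Rightarrow> real) \<Rightarrow> ('s \<times> real) measure \<Rightarrow> real \<Rightarrow> 'h" where
  "f_pseudo eval_at P l =
     arg_min (\<lambda>f. (\<integral>z. (snd z - eval_at f (fst z))\<^sup>2 \<partial>P) + l * (norm f)\<^sup>2) (\<lambda>f. True)"

definition f_hat ::
  "('h::real_normed_vector \<Rightarrow> 's \<Rightarrow> real) \<Rightarrow> nat \<Rightarrow> (nat \<Rightarrow> 's \<times> real) \<Rightarrow> real \<Rightarrow> 'h" where
  "f_hat eval_at n d l =
     arg_min (\<lambda>f. (1 / real n) * (\<Sum>i<n. (snd (d i) - eval_at f (fst (d i)))\<^sup>2) + l * (norm f)\<^sup>2)
       (\<lambda>f. True)"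

text \<open>
  If the regression function \<open>f\<^sub>0\<close> lies in the Hilbert space, the bracket below equals
  \<open>(k\<^sub>x \<otimes> k\<^sub>x - T) (f\<^sub>0 - f\<^sub>l) + (y - f\<^sub>0 x) k\<^sub>x\<close>, because
  \<open>(T + l) f\<^sub>l = T f\<^sub>0\<close>; the form used here also makes sense without that assumption.
\<close>

definition influence ::
  "('s \<Rightarrow> 's \<Rightarrow> real) \<Rightarrow> ('h \<Rightarrow> 's \<Rightarrow> real) \<Rightarrow> ('s \<times> real) measure \<Rightarrow> real
     \<Rightarrow> 's \<times> real \<Rightarrow> 'h::{real_inner, banach, second_countable_topology}" where
  "influence k eval_at P l z =
     resolvent (pop_operator k eval_at P) l
       ((snd z - eval_at (f_pseudo eval_at P l) (fst z)) *\<^sub>R kernel_section eval_at k (fst z)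
          - l *\<^sub>R f_pseudo eval_at P l)"

definition Sigma_op ::
  "('s \<Rightarrow> 's \<Rightarrow> real) \<Rightarrow> ('h \<Rightarrow> 's \<Rightarrow> real) \<Rightarrow> ('s \<times> real) measure \<Rightarrow> real
     \<Rightarrow> 'h \<Rightarrow> 'h::{real_inner, banach, second_countable_topology}" where
  "Sigma_op k eval_at P l =
     op_expectation P (\<lambda>z. rank_one (influence k eval_at P l z) (influence k eval_at P l z))"

definition V_hat ::
  "('s \<Rightarrow> 's \<Rightarrow> real) \<Rightarrow> ('h \<Rightarrow> 's \<Rightarrow> real) \<Rightarrow> nat \<Rightarrow> (nat \<Rightarrow> 's \<times> real) \<Rightarrow> real
     \<Rightarrow> nat \<Rightarrow> 'h::real_inner" where
  "V_hat k eval_at n d l i =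
     resolvent (emp_operator k eval_at n d) l
       ((snd (d i) - eval_at (f_hat eval_at n d l) (fst (d i))) *\<^sub>R kernel_section eval_at k (fst (d i)))"

definition bootstrap ::
  "('s \<Rightarrow> 's \<Rightarrow> real) \<Rightarrow> ('h \<Rightarrow> 's \<Rightarrow> real) \<Rightarrow> nat \<Rightarrow> (nat \<Rightarrow> 's \<times> real) \<Rightarrow> real
     \<Rightarrow> (nat \<Rightarrow> nat \<Rightarrow> real) \<Rightarrow> 'h::real_inner" where
  "bootstrap k eval_at n d l g =
     (1 / real n) *\<^sub>R
       (\<Sum>i<n. \<Sum>j<n. g i j *\<^sub>R ((1 / sqrt 2) *\<^sub>R (V_hat k eval_at n d l i - V_hat k eval_at n d l j)))"

definition conf_set ::
  "('h::real_normed_vector \<Rightarrow> 's \<Rightarrow> real) \<Rightarrow> nat \<Rightarrow> (nat \<Rightarrow> 's \<times> real) \<Rightarrow> real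
     \<Rightarrow> real \<Rightarrow> real \<Rightarrow> 'h set" where
  "conf_set eval_at n d l t \<delta> =
     {f_hat eval_at n d l + (t / sqrt (real n)) *\<^sub>R f | f. norm f \<le> 1 + \<delta>}"

definition modulus_of_continuity :: "(real \<Rightarrow> real) \<Rightarrow> bool" where
  "modulus_of_continuity \<psi> \<longleftrightarrow>
     (\<forall>r\<ge>0. 0 \<le> \<psi> r) \<and> mono_on {0..} \<psi> \<and> \<psi> 0 = 0 \<and> (\<psi> \<longlongrightarrow> 0) (at_right 0)"

text \<open>
  Measurability of the sections of \<open>k\<close> is what makes \<open>x \<mapsto> k\<^sub>x\<close> a measurable
  map into the (separable) Hilbert space.
\<close>

locale krr_setting = prob_space M
  for M :: "'w measure" +
  fixes k :: "'s::polish_space \<Rightarrow> 's \<Rightarrow> real"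
    and eval_at :: "'h::{real_inner, banach, second_countable_topology} \<Rightarrow> 's \<Rightarrow> real"
    and P :: "('s \<times> real) measure"
    and f0 :: "'s \<Rightarrow> real"
    and n :: nat
    and D :: "nat \<Rightarrow> 'w \<Rightarrow> 's \<times> real"
    and h :: "nat \<Rightarrow> nat \<Rightarrow> 'w \<Rightarrow> real"
    and \<kappa> \<sigma>_up \<sigma>_lo :: real
  assumes kernel: "positive_definite_kernel k"
    and kernel_bounded: "k x x' \<le> \<kappa>\<^sup>2"
    and kernel_measurable: "k x \<in> borel_measurable borel"
    and rkhs: "is_rkhs k eval_at"
    and n_pos: "n > 0"
    and data_indep: "indep_vars (\<lambda>_. borel) D {..<n}"
    and data_law: "i < n \<Longrightarrow> distr M borel (D i) = P"
    and Y_integrable: "integrable P snd"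
    and f0_measurable: "f0 \<in> borel_measurable borel"
    and f0_regression:
      "AE z in P. real_cond_exp P (vimage_algebra (space P) fst borel) snd z = f0 (fst z)"
    and noise_bounded: "AE z in P. \<bar>snd z - f0 (fst z)\<bar> \<le> \<sigma>_up"
    and \<sigma>_lo_pos: "\<sigma>_lo > 0"
    and noise_variance:
      "AE z in P. real_cond_exp P (vimage_algebra (space P) fst borel)
          (\<lambda>z. (snd z - f0 (fst z))\<^sup>2) z \<ge> \<sigma>_lo\<^sup>2"
    and h_normal: "i < n \<Longrightarrow> j < n \<Longrightarrow> distributed M lborel (h i j) std_normal_density"
    and h_indep: "indep_vars (\<lambda>_. borel) (\<lambda>(i, j). h i j) ({..<n} \<times> {..<n})"
    and h_indep_data:
      "indep_set (sets (data_sigma M n D))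
         (sets (vimage_algebra (space M) (\<lambda>w. \<lambda>p\<in>{..<n} \<times> {..<n}. h (fst p) (snd p) w)
            (\<Pi>\<^sub>M p\<in>{..<n} \<times> {..<n}. borel)))"

end

theory Submission
  imports Defs
begin

text \<open>
  The two couplings say that \<open>sqrt n (f_hat - f_lambda)\<close> is close to \<open>Z\<close>, and that, given the
  data, the bootstrap element is close to \<open>Z'\<close>.  For a functional \<open>F\<close> with modulus \<open>\<psi>\<close> a coupling
  within distance \<open>r\<close> that fails with probability at most \<open>\<eta>\<close> sandwiches one distribution function
  between two shifts of the other: \<open>P (F X \<le> t) \<le> P (F Y \<le> t + \<psi> r) + \<eta>\<close> and conversely
  (\<open>cdf_sandwich_of_coupling\<close>, and \<open>cond_cdf_sandwich_of_coupling\<close> given the data).  The conditional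
  law of \<open>Z'\<close> and the law of \<open>Z\<close> are centred Gaussian with the same covariance, hence equal
  (\<open>centered_gaussian_eqI\<close>), so both sandwiches are around the one distribution function of
  \<open>F Z\<close>, through which the other two are compared.

  For the Kolmogorov bounds this is all that is needed: shifting \<open>t\<close> by \<open>r\<close> changes a distribution
  function by at most the mass of \<open>[t - r, t + r]\<close>, measured either under \<open>F Z\<close> or under the
  bootstrap distribution.

  For the coverage statements \<open>F\<close> is the norm.  The sandwich puts \<open>t_hat + R\<close> above the
  \<open>(1 - \<alpha> - \<eta>)\<close>-quantile of \<open>norm Z\<close> and \<open>t_hat - R\<close> below its \<open>(1 - \<alpha> + \<eta>)\<close>-quantile.  Since
  the former quantile is at least the lower bound \<open>L\<close>, the radius satisfies \<open>t_hat \<ge> L - R\<close>, and the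
  condition on \<open>\<delta>\<close> becomes \<open>Q + R \<le> \<delta> t_hat\<close>: inflating or deflating the radius by the factor
  \<open>1 \<plusminus> \<delta>\<close> absorbs both coupling errors (\<open>coverage_of_coupling\<close>).

  The probabilities in the conclusion are meaningful only for measurable events, so
  \<open>f_hat\<close>, defined as an arg min over the Hilbert space, has to be shown to be a random element.
  It is the limit of gradient descent, whose iterates are measurable because \<open>x \<mapsto> k x\<close> is
  (\<open>measurable_f_hat\<close>, \<open>measurable_kernel_section\<close>).
\<close>

section \<open>Half-spaces generate the Borel sets of a separable Hilbert space\<close>

text \<open>
  A ball is cut out by the half-spaces that contain it.  By continuity of the defining inequality in
  the normal vector \<open>d\<close> it suffices to let \<open>d\<close> range over a dense set, which makes the intersection
  countable in a separable space.
\<close>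

lemma cball_eq_Inter_halfspaces:
  fixes c :: "'h::real_inner"
  assumes dense: "\<And>X::'h set. open X \<Longrightarrow> X \<noteq> {} \<Longrightarrow> \<exists>d\<in>C. d \<in> X" and "0 \<le> r"
  shows "cball c r = (\<Inter>d\<in>C. {x. inner d x \<le> inner d c + r * norm d})"
proof (rule set_eqI, rule iffI)
  fix x assume x: "x \<in> cball c r"
  have "inner d x \<le> inner d c + r * norm d" for d
  proof -
    have "inner d x - inner d c = inner d (x - c)" by (simp add: inner_diff_right)
    also have "\<dots> \<le> norm d * norm (x - c)" by (rule norm_cauchy_schwarz)
    also have "\<dots> \<le> norm d * r"
      using x by (intro mult_left_mono) (auto simp: dist_norm norm_minus_commute)
    finally show ?thesis by (simp add: mult.commute)
  qed
  then show "x \<in> (\<Inter>d\<in>C. {x. inner d x \<le> inner d c + r * norm d})" by auto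
next
  fix x assume x: "x \<in> (\<Inter>d\<in>C. {x. inner d x \<le> inner d c + r * norm d})"
  have "open {d. inner d c + r * norm d < inner d x}"
    by (intro open_Collect_less continuous_intros)
  with dense x have "{d. inner d c + r * norm d < inner d x} = {}" by force
  then have "\<not> inner (x - c) c + r * norm (x - c) < inner (x - c) x"
    by blast
  then have "norm (x - c) * norm (x - c) \<le> r * norm (x - c)"
    by (simp add: power2_norm_eq_inner inner_diff_right flip: power2_eq_square)
  then have "norm (x - c) \<le> r" using \<open>0 \<le> r\<close> by (cases "x = c") auto
  then show "x \<in> cball c r" by (simp add: dist_norm norm_minus_commute)
qed

text \<open>
  Every open set is a countable union of balls with centres in a dense set and rational radii, and
  balls are countable intersections of half-spaces.
\<close>

lemma borel_eq_sigma_halfspaces: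
  "(borel :: 'h::{real_inner, second_countable_topology} measure)
     = sigma UNIV (range (\<lambda>(u, r). {x. inner u x \<le> r}))" (is "_ = sigma UNIV ?E")
proof -
  obtain C :: "'h set" where C: "countable C" and
    dense: "\<And>X::'h set. open X \<Longrightarrow> X \<noteq> {} \<Longrightarrow> \<exists>d\<in>C. d \<in> X"
    by (rule countable_dense_setE) blast
  have Cne: "C \<noteq> {}" using dense[of UNIV] by auto
  have half: "{x. inner u x \<le> r} \<in> sets (sigma UNIV ?E)" for u :: 'h and r
    by (auto intro!: sigma_sets.Basic range_eqI[of _ _ "(u, r)"])
  have cball: "cball c r \<in> sets (sigma UNIV ?E)" if r: "0 \<le> r" for c :: 'h and r
  proof -
    have "cball c r = (\<Inter>d\<in>C. {x. inner d x \<le> inner d c + r * norm d})"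
      using dense r by (rule cball_eq_Inter_halfspaces)
    also have "\<dots> \<in> sets (sigma UNIV ?E)"
      using C Cne half by (intro sets.countable_INT') blast+
    finally show ?thesis .
  qed
  have "S \<in> sets (sigma UNIV ?E)" if S: "open S" for S
  proof -
    define I where "I = {(c, r). c \<in> C \<and> r \<in> \<rat> \<and> 0 < r \<and> cball c r \<subseteq> S}"
    have "countable I"
      by (rule countable_subset[of _ "C \<times> \<rat>"]) (auto simp: I_def C countable_rat)
    have "S = (\<Union>(c, r)\<in>I. cball c r)"
    proof (rule set_eqI, rule iffI)
      fix x assume "x \<in> S"
      then obtain e where e: "e > 0" "ball x e \<subseteq> S" using S open_contains_ball by blast
      obtain r where r: "r \<in> \<rat>" "0 < r" "r < e / 2"
        using Rats_dense_in_real[of 0 "e/2"] e by auto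
      obtain c where c: "c \<in> C" "c \<in> ball x r"
        using dense[of "ball x r"] r by auto
      have "cball c r \<subseteq> ball x e"
      proof
        fix y assume "y \<in> cball c r"
        then have "dist x y < e"
          using dist_triangle[of x y c] c r by auto
        then show "y \<in> ball x e" by simp
      qed
      then have "(c, r) \<in> I" using c r e by (auto simp: I_def)
      then show "x \<in> (\<Union>(c, r)\<in>I. cball c r)"
        using c by (intro UN_I[of "(c, r)"]) (auto simp: dist_commute)
    qed (auto simp: I_def)
    also have "\<dots> \<in> sets (sigma UNIV ?E)"
      using cball by (intro sets.countable_UN'[OF \<open>countable I\<close>]) (auto simp: I_def)
    finally show ?thesis .
  qed
  then show ?thesis
    by (intro borel_eq_sigmaI1[OF borel_def]) (auto simp: split_beta)
qed

text \<open>
  Weak measurability is measurability: preimages of half-spaces only involve the scalar functions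
  \<open>x \<mapsto> inner u (f x)\<close>.
\<close>

lemma measurable_of_inner:
  fixes f :: "'a \<Rightarrow> 'h::{real_inner, second_countable_topology}"
  assumes "\<And>u. (\<lambda>x. inner u (f x)) \<in> borel_measurable M"
  shows "f \<in> borel_measurable M"
  unfolding borel_eq_sigma_halfspaces
proof (rule measurable_measure_of)
  fix S assume "S \<in> range (\<lambda>(u :: 'h, r). {x. inner u x \<le> r})"
  then obtain u r where "S = {x. inner u x \<le> r}" by auto
  then have "f -` S \<inter> space M = {x \<in> space M. inner u (f x) \<le> r}" by auto
  also have "\<dots> \<in> sets M"
    using assms[of u] by measurable
  finally show "f -` S \<inter> space M \<in> sets M" .
qed auto

section \<open>Measures on a Hilbert space are determined by their one-dimensional marginals\<close>

text \<open>
  Uniqueness of characteristic functions for the unnormalised measures \<open>w d\<mu>\<close> and \<open>w d\<nu>\<close> pushed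
  forward by \<open>X\<close>: their common mass \<open>c\<close> is the transform at \<open>0\<close>, and unless it vanishes division by
  \<open>c\<close> reduces the claim to Levy's theorem for probability measures.
\<close>

lemma weighted_cdf_eqI:
  fixes \<mu> \<nu> :: "'a measure" and X w :: "'a \<Rightarrow> real"
  assumes "prob_space \<mu>" "prob_space \<nu>" and sets: "sets \<nu> = sets \<mu>"
    and X[measurable]: "X \<in> borel_measurable \<mu>" and w[measurable]: "w \<in> borel_measurable \<mu>"
    and w_bounds: "\<And>x. 0 \<le> w x" "\<And>x. w x \<le> C"
    and cos_eq: "\<And>t. (\<integral>x. w x * cos (t * X x) \<partial>\<mu>) = (\<integral>x. w x * cos (t * X x) \<partial>\<nu>)"
    and sin_eq: "\<And>t. (\<integral>x. w x * sin (t * X x) \<partial>\<mu>) = (\<integral>x. w x * sin (t * X x) \<partial>\<nu>)"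
    and A[measurable]: "A \<in> sets borel"
  shows "(\<integral>x. w x * indicator A (X x) \<partial>\<mu>) = (\<integral>x. w x * indicator A (X x) \<partial>\<nu>)"
proof -
  interpret \<mu>: prob_space \<mu> by fact
  interpret \<nu>: prob_space \<nu> by fact
  have X': "X \<in> borel_measurable \<nu>" and w': "w \<in> borel_measurable \<nu>"
    using X w by (simp_all cong: measurable_cong_sets add: measurable_cong_sets[OF sets refl])
  have int: "integrable \<rho> (\<lambda>x. w x * g x)"
    if "\<rho> = \<mu> \<or> \<rho> = \<nu>" "g \<in> borel_measurable \<rho>" "\<And>x. \<bar>g x\<bar> \<le> 1" for \<rho> and g :: "'a \<Rightarrow> real"
  proof (rule finite_measure.integrable_const_bound[of _ _ C])
    show "finite_measure \<rho>"
      using that(1) \<mu>.finite_measure_axioms \<nu>.finite_measure_axioms by auto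
    have "\<bar>w x * g x\<bar> \<le> C * 1" for x
      unfolding abs_mult using w_bounds[of x] that(3)[of x] by (intro mult_mono) linarith+
    then show "AE x in \<rho>. norm (w x * g x) \<le> C" by simp
    show "(\<lambda>x. w x * g x) \<in> borel_measurable \<rho>"
      using that w w' by (auto intro: borel_measurable_times)
  qed
  define c where "c = (\<integral>x. w x \<partial>\<mu>)"
  have c_eq: "(\<integral>x. w x \<partial>\<nu>) = c"
    using cos_eq[of 0] by (simp add: c_def)
  have int_w: "integrable \<rho> w" if "\<rho> = \<mu> \<or> \<rho> = \<nu>" for \<rho>
    using int[OF that, of "\<lambda>_. 1"] by simp
  have Xm: "X \<in> borel_measurable \<rho>" "w \<in> borel_measurable \<rho>" if "\<rho> = \<mu> \<or> \<rho> = \<nu>" for \<rho>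
    using that X X' w w' by auto
  have "c \<ge> 0" unfolding c_def using w_bounds by (intro Bochner_Integration.integral_nonneg) auto
  show ?thesis
  proof (cases "c = 0")
    case True
    have "(\<integral>x. w x * indicator A (X x) \<partial>\<rho>) = 0" if \<rho>: "\<rho> = \<mu> \<or> \<rho> = \<nu>" for \<rho>
    proof (rule antisym)
      have "(\<lambda>x. indicator A (X x) :: real) \<in> borel_measurable \<rho>"
        using Xm(1)[OF \<rho>] by measurable
      then have "(\<integral>x. w x * indicator A (X x) \<partial>\<rho>) \<le> (\<integral>x. w x \<partial>\<rho>)"
        using w_bounds by (intro Bochner_Integration.integral_mono int int_w \<rho>) (auto simp: indicator_def)
      then show "(\<integral>x. w x * indicator A (X x) \<partial>\<rho>) \<le> 0"
        using True c_eq c_def \<rho> by auto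
      show "0 \<le> (\<integral>x. w x * indicator A (X x) \<partial>\<rho>)"
        using w_bounds by (intro Bochner_Integration.integral_nonneg) auto
    qed
    then show ?thesis by simp
  next
    case False
    with \<open>c \<ge> 0\<close> have "c > 0" by simp
    define N where "N \<rho> = distr (density \<rho> (\<lambda>x. ennreal (w x / c))) borel X" for \<rho>
    have dens: "(\<lambda>x. w x / c) \<in> borel_measurable \<rho>" if "\<rho> = \<mu> \<or> \<rho> = \<nu>" for \<rho>
      using Xm[OF that] by measurable
    have real_N: "real_distribution (N \<rho>)" if \<rho>: "\<rho> = \<mu> \<or> \<rho> = \<nu>" for \<rho>
    proof -
      have "emeasure (density \<rho> (\<lambda>x. ennreal (w x / c))) (space \<rho>) = (\<integral>\<^sup>+x. ennreal (w x / c) \<partial>\<rho>)"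
        using dens[OF \<rho>] by (subst emeasure_density) (auto intro!: nn_integral_cong)
      also have "\<dots> = ennreal (\<integral>x. w x / c \<partial>\<rho>)"
        using int_w[OF \<rho>] w_bounds \<open>c > 0\<close> by (intro nn_integral_eq_integral) auto
      also have "(\<integral>x. w x / c \<partial>\<rho>) = 1"
        using \<rho> c_eq c_def \<open>c > 0\<close> by auto
      finally have "prob_space (density \<rho> (\<lambda>x. ennreal (w x / c)))"
        by (intro prob_spaceI) simp
      then have "prob_space (N \<rho>)"
        unfolding N_def using Xm(1)[OF \<rho>] by (intro prob_space.prob_space_distr) auto
      then show ?thesis
        by (intro real_distribution.intro real_distribution_axioms.intro) (auto simp: N_def)
    qed
    have char_N: "char (N \<rho>) t = Complex ((\<integral>x. w x * cos (t * X x) \<partial>\<rho>) / c) ((\<integral>x. w x * sin (t * X x) \<partial>\<rho>) / c)"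
      if \<rho>: "\<rho> = \<mu> \<or> \<rho> = \<nu>" for \<rho> t
    proof -
      note [measurable] = Xm[OF \<rho>]
      have ints: "integrable \<rho> (\<lambda>x. w x * cos (t * X x))" "integrable \<rho> (\<lambda>x. w x * sin (t * X x))"
        by (intro int \<rho>; measurable; simp)+
      have "char (N \<rho>) t = (\<integral>x. (w x / c) *\<^sub>R iexp (t * X x) \<partial>\<rho>)"
        unfolding char_def N_def using w_bounds \<open>c > 0\<close>
        by (subst integral_distr, measurable, subst integral_density) auto
      also have "\<dots> = (\<integral>x. complex_of_real (w x * cos (t * X x) / c)
                              + \<i> * complex_of_real (w x * sin (t * X x) / c) \<partial>\<rho>)"
        by (intro Bochner_Integration.integral_cong refl)
           (simp add: complex_eq_iff Re_exp Im_exp)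
      also have "\<dots> = complex_of_real (\<integral>x. w x * cos (t * X x) / c \<partial>\<rho>)
                      + \<i> * complex_of_real (\<integral>x. w x * sin (t * X x) / c \<partial>\<rho>)"
        using ints by (subst Bochner_Integration.integral_add) (auto simp del: of_real_mult of_real_divide)
      also have "\<dots> = Complex ((\<integral>x. w x * cos (t * X x) \<partial>\<rho>) / c) ((\<integral>x. w x * sin (t * X x) \<partial>\<rho>) / c)"
        by (simp add: complex_eq_iff)
      finally show ?thesis .
    qed
    have "N \<mu> = N \<nu>"
      using char_N cos_eq sin_eq by (intro Levy_uniqueness real_N ext) auto
    moreover have "measure (N \<rho>) A = (\<integral>x. w x * indicator A (X x) \<partial>\<rho>) / c" if \<rho>: "\<rho> = \<mu> \<or> \<rho> = \<nu>" for \<rho>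
    proof -
      note [measurable] = Xm[OF \<rho>]
      interpret N: real_distribution "N \<rho>" by (rule real_N[OF \<rho>])
      have "measure (N \<rho>) A = (\<integral>x. indicator A x \<partial>N \<rho>)" by simp
      also have "\<dots> = (\<integral>x. (w x / c) *\<^sub>R indicator A (X x) \<partial>\<rho>)"
        unfolding N_def using w_bounds \<open>c > 0\<close>
        by (subst integral_distr, measurable, subst integral_density) auto
      also have "\<dots> = (\<integral>x. w x * indicator A (X x) \<partial>\<rho>) / c" by simp
      finally show ?thesis .
    qed
    ultimately have "(\<integral>x. w x * indicator A (X x) \<partial>\<mu>) / c = (\<integral>x. w x * indicator A (X x) \<partial>\<nu>) / c"
      by metis
    then show ?thesis using \<open>c > 0\<close> by simp
  qed
qed

text \<open>
  The Cramer-Wold device in a separable inner product space.  Let \<open>good S\<close> mean that the measures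
  restricted to \<open>S\<close> have the same characteristic functional.  The whole space is good because the
  marginals agree, and goodness is preserved under intersection with a half-space
  \<open>{x. inner v x \<le> r}\<close>: restricted to \<open>S\<close> and weighted with \<open>1 + cos (inner u x)\<close> or
  \<open>1 + sin (inner u x)\<close>, the two distributions of \<open>inner v x\<close> have the same characteristic function,
  because a product of trigonometric functions of linear forms is a sum of such functions.
  Finite intersections of half-spaces therefore form a generating \<open>\<pi>\<close>-system on which the measures
  agree.  The induction adds one direction at a time, so that only the one-dimensional uniqueness
  theorem is used.
\<close>

lemma measure_eqI_inner_distr:
  fixes \<mu> \<nu> :: "'h::{real_inner, second_countable_topology} measure"
  assumes "prob_space \<mu>" "prob_space \<nu>"
    and sets_\<mu>: "sets \<mu> = sets borel" and sets_\<nu>: "sets \<nu> = sets borel"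
    and marginals: "\<And>u. distr \<mu> borel (inner u) = distr \<nu> borel (inner u)"
  shows "\<mu> = \<nu>"
proof -
  interpret \<mu>: prob_space \<mu> by fact
  interpret \<nu>: prob_space \<nu> by fact
  have space: "space \<mu> = UNIV" "space \<nu> = UNIV"
    using sets_eq_imp_space_eq[OF sets_\<mu>] sets_eq_imp_space_eq[OF sets_\<nu>] by auto
  note [measurable_cong] = sets_\<mu> sets_\<nu>
  define good where "good S \<longleftrightarrow> S \<in> sets borel \<and>
    (\<forall>u. (\<integral>x. indicator S x * cos (inner u x) \<partial>\<mu>) = (\<integral>x. indicator S x * cos (inner u x) \<partial>\<nu>) \<and>
         (\<integral>x. indicator S x * sin (inner u x) \<partial>\<mu>) = (\<integral>x. indicator S x * sin (inner u x) \<partial>\<nu>))"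
    for S :: "'h set"
  have int: "integrable \<rho> (f :: 'h \<Rightarrow> real)"
    if "\<rho> = \<mu> \<or> \<rho> = \<nu>" "f \<in> borel_measurable borel" "\<And>x. \<bar>f x\<bar> \<le> 1" for \<rho> f
  proof -
    have "f \<in> borel_measurable \<rho>"
      using that measurable_cong_sets[OF sets_\<mu> refl] measurable_cong_sets[OF sets_\<nu> refl] by blast
    moreover have "finite_measure \<rho>"
      using that(1) \<mu>.finite_measure_axioms \<nu>.finite_measure_axioms by auto
    ultimately show ?thesis
      using that(3) by (intro finite_measure.integrable_const_bound[of _ _ 1]) auto
  qed
  have good_UNIV: "good UNIV"
  proof -
    have "(\<integral>x. f (inner u x) \<partial>\<mu>) = (\<integral>x. f (inner u x) \<partial>\<nu>)"
      if "f \<in> borel_measurable borel" for f :: "real \<Rightarrow> real" and u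
    proof -
      have "(\<integral>x. f (inner u x) \<partial>\<mu>) = (\<integral>y. f y \<partial>distr \<mu> borel (inner u))"
        using that by (subst integral_distr) auto
      also have "\<dots> = (\<integral>x. f (inner u x) \<partial>\<nu>)"
        unfolding marginals using that by (subst integral_distr) auto
      finally show ?thesis .
    qed
    from this[of cos] this[of sin] show ?thesis by (simp add: good_def)
  qed
  have good_Int: "good (S \<inter> {x. inner v x \<le> r})" if S: "good S" for S v r
  proof -
    have Sm[measurable]: "S \<in> sets borel" using S by (simp add: good_def)
    have cosS: "(\<integral>x. indicator S x * cos (inner u x) \<partial>\<mu>) = (\<integral>x. indicator S x * cos (inner u x) \<partial>\<nu>)"
      and sinS: "(\<integral>x. indicator S x * sin (inner u x) \<partial>\<mu>) = (\<integral>x. indicator S x * sin (inner u x) \<partial>\<nu>)" for u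
      using S by (auto simp: good_def)
    have cos1: "indicator S x * (1 + \<phi>) * \<tau> = indicator S x * \<tau> + indicator S x * (\<phi> * \<tau>)"
      for x and \<phi> \<tau> :: real by (simp add: algebra_simps)
    have bnd: "\<bar>indicator S x * y\<bar> \<le> 1" if "\<bar>y\<bar> \<le> 1" for x and y :: real
      using that by (auto simp: indicator_def)
    have ints: "integrable \<rho> (\<lambda>x. indicator S x * cos (inner u x))"
      "integrable \<rho> (\<lambda>x. indicator S x * sin (inner u x))" if "\<rho> = \<mu> \<or> \<rho> = \<nu>" for \<rho> u
      by (intro int that bnd; measurable; simp)+
    \<comment> \<open>Adding \<open>1\<close> makes the trigonometric weight nonnegative.  The contribution of the \<open>1\<close>
        cancels in the end: the case \<open>g = sin\<close>, \<open>u = 0\<close> shows that the masses of the intersection agree.\<close>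
    have key: "(\<integral>x. indicator S x * (1 + g (inner u x)) * indicator {..r} (inner v x) \<partial>\<mu>)
             = (\<integral>x. indicator S x * (1 + g (inner u x)) * indicator {..r} (inner v x) \<partial>\<nu>)"
      if g: "g = cos \<or> g = sin" for g u
    proof (rule weighted_cdf_eqI[where C = 2])
      have [measurable]: "g \<in> borel_measurable borel" using g by auto
      show "(\<lambda>x. indicator S x * (1 + g (inner u x))) \<in> borel_measurable \<mu>" by measurable
      have "\<bar>g y\<bar> \<le> 1" for y using g by auto
      then have g1: "-1 \<le> g y" "g y \<le> 1" for y by (simp_all add: abs_le_iff minus_le_iff)
      show "0 \<le> indicator S x * (1 + g (inner u x))" for x
        using g1(1)[of "inner u x"] by (simp add: indicator_def)
      show "indicator S x * (1 + g (inner u x)) \<le> 2" for x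
        using g1(2)[of "inner u x"] by (simp add: indicator_def)
      have prods:
        "cos (inner u x) * cos (t * inner v x) = (cos (inner (u - t *\<^sub>R v) x) + cos (inner (u + t *\<^sub>R v) x)) / 2"
        "cos (inner u x) * sin (t * inner v x) = (sin (inner (u + t *\<^sub>R v) x) - sin (inner (u - t *\<^sub>R v) x)) / 2"
        "sin (inner u x) * cos (t * inner v x) = (sin (inner (u + t *\<^sub>R v) x) + sin (inner (u - t *\<^sub>R v) x)) / 2"
        "sin (inner u x) * sin (t * inner v x) = (cos (inner (u - t *\<^sub>R v) x) - cos (inner (u + t *\<^sub>R v) x)) / 2" for t x
        by (simp_all add: cos_times_cos cos_times_sin sin_times_cos sin_times_sin inner_add_left inner_diff_left)
      have cc: "indicator S x * (1 + cos (inner u x)) * cos (t * inner v x)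
          = indicator S x * cos (inner (t *\<^sub>R v) x)
            + (indicator S x * cos (inner (u - t *\<^sub>R v) x) + indicator S x * cos (inner (u + t *\<^sub>R v) x)) / 2" for t x
        unfolding cos1 prods by (simp add: distrib_left right_diff_distrib)
      have cs: "indicator S x * (1 + cos (inner u x)) * sin (t * inner v x)
          = indicator S x * sin (inner (t *\<^sub>R v) x)
            + (indicator S x * sin (inner (u + t *\<^sub>R v) x) - indicator S x * sin (inner (u - t *\<^sub>R v) x)) / 2" for t x
        unfolding cos1 prods by (simp add: distrib_left right_diff_distrib)
      have sc: "indicator S x * (1 + sin (inner u x)) * cos (t * inner v x)
          = indicator S x * cos (inner (t *\<^sub>R v) x)
            + (indicator S x * sin (inner (u + t *\<^sub>R v) x) + indicator S x * sin (inner (u - t *\<^sub>R v) x)) / 2" for t x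
        unfolding cos1 prods by (simp add: distrib_left right_diff_distrib)
      have ss: "indicator S x * (1 + sin (inner u x)) * sin (t * inner v x)
          = indicator S x * sin (inner (t *\<^sub>R v) x)
            + (indicator S x * cos (inner (u - t *\<^sub>R v) x) - indicator S x * cos (inner (u + t *\<^sub>R v) x)) / 2" for t x
        unfolding cos1 prods by (simp add: distrib_left right_diff_distrib)
      show "(\<integral>x. indicator S x * (1 + g (inner u x)) * cos (t * inner v x) \<partial>\<mu>)
          = (\<integral>x. indicator S x * (1 + g (inner u x)) * cos (t * inner v x) \<partial>\<nu>)" for t
        using g
      proof
        assume "g = cos"
        then show ?thesis by (simp only: cc) (simp add: cosS sinS ints del: inner_scaleR_left)
      next
        assume "g = sin"
        then show ?thesis by (simp only: sc) (simp add: cosS sinS ints del: inner_scaleR_left)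
      qed
      show "(\<integral>x. indicator S x * (1 + g (inner u x)) * sin (t * inner v x) \<partial>\<mu>)
          = (\<integral>x. indicator S x * (1 + g (inner u x)) * sin (t * inner v x) \<partial>\<nu>)" for t
        using g
      proof
        assume "g = cos"
        then show ?thesis by (simp only: cs) (simp add: cosS sinS ints del: inner_scaleR_left)
      next
        assume "g = sin"
        then show ?thesis by (simp only: ss) (simp add: cosS sinS ints del: inner_scaleR_left)
      qed
    qed (use assms sets_\<mu> sets_\<nu> in auto)
    let ?T = "S \<inter> {x. inner v x \<le> r}"
    have T: "indicator S x * indicator {..r} (inner v x) = (indicator ?T x :: real)" for x
      by (auto simp: indicator_def)
    have Tm[measurable]: "?T \<in> sets borel" by measurable
    have intT: "integrable \<rho> (\<lambda>x. indicator ?T x * g (inner u x))" "integrable \<rho> (indicator ?T :: 'h \<Rightarrow> real)"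
      if "\<rho> = \<mu> \<or> \<rho> = \<nu>" "g = cos \<or> g = sin" for \<rho> u and g :: "real \<Rightarrow> real"
    proof -
      have [measurable]: "g \<in> borel_measurable borel" using that by auto
      show "integrable \<rho> (\<lambda>x. indicator ?T x * g (inner u x))"
        using that(2) by (intro int[OF that(1)]) (measurable, auto simp: indicator_def)
      show "integrable \<rho> (indicator ?T :: 'h \<Rightarrow> real)"
        by (rule int[OF that(1) borel_measurable_indicator[OF Tm]]) (simp add: indicator_def)
    qed
    have split: "indicator S x * (1 + y) * indicator {..r} (inner v x)
        = indicator ?T x + indicator ?T x * y" for x and y :: real
      by (simp add: algebra_simps flip: T)
    have key': "(\<integral>x. indicator ?T x \<partial>\<mu>) + (\<integral>x. indicator ?T x * g (inner u x) \<partial>\<mu>)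
             = (\<integral>x. indicator ?T x \<partial>\<nu>) + (\<integral>x. indicator ?T x * g (inner u x) \<partial>\<nu>)"
      if g: "g = cos \<or> g = sin" for g u
      using key[OF g, of u] unfolding split
        Bochner_Integration.integral_add[OF intT(2)[OF disjI1[OF refl] g] intT(1)[OF disjI1[OF refl] g]]
        Bochner_Integration.integral_add[OF intT(2)[OF disjI2[OF refl] g] intT(1)[OF disjI2[OF refl] g]] .
    have "(\<integral>x. indicator ?T x \<partial>\<mu>) = (\<integral>x. indicator ?T x \<partial>\<nu> :: real)"
      using key'[of sin 0] by simp
    then show ?thesis
      using key'[of cos] key'[of sin] Tm by (simp add: good_def)
  qed
  define E where "E = range (\<lambda>us. {x :: 'h. \<forall>(u, r)\<in>set us. inner u x \<le> r})"
  have good_E: "good S" if "S \<in> E" for S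
  proof -
    obtain us where S: "S = {x. \<forall>(u, r)\<in>set us. inner u x \<le> r}" using \<open>S \<in> E\<close> by (auto simp: E_def)
    have "good {x. \<forall>(u, r)\<in>set us. inner u x \<le> r}"
    proof (induction us)
      case Nil
      then show ?case using good_UNIV by simp
    next
      case (Cons ur us)
      obtain u r where ur: "ur = (u, r)" by fastforce
      have "{x. \<forall>(u, r)\<in>set (ur # us). inner u x \<le> r}
          = {x. \<forall>(u, r)\<in>set us. inner u x \<le> r} \<inter> {x. inner u x \<le> r}" by (auto simp: ur)
      then show ?case using good_Int[OF Cons] by simp
    qed
    then show ?thesis by (simp add: S)
  qed
  have sets_borel_E: "sets (borel :: 'h measure) = sigma_sets UNIV E"
  proof -
    have "sigma_sets UNIV (range (\<lambda>(u :: 'h, r). {x. inner u x \<le> r})) \<subseteq> sigma_sets UNIV E"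
    proof (rule sigma_sets_mono')
      show "range (\<lambda>(u :: 'h, r). {x. inner u x \<le> r}) \<subseteq> E"
      proof
        fix S assume "S \<in> range (\<lambda>(u :: 'h, r). {x. inner u x \<le> r})"
        then obtain u r where "S = {x. inner u x \<le> r}" by auto
        then have "S = {x. \<forall>(u, r)\<in>set [(u, r)]. inner u x \<le> r}" by simp
        then show "S \<in> E" unfolding E_def by (rule range_eqI)
      qed
    qed
    moreover have "sigma_sets UNIV E \<subseteq> sets (borel :: 'h measure)"
      using good_E by (intro sets.sigma_sets_subset[of _ borel, simplified]) (auto simp: good_def)
    ultimately show ?thesis
      unfolding borel_eq_sigma_halfspaces by auto
  qed
  show ?thesis
  proof (rule measure_eqI_generator_eq[of E UNIV _ _ "\<lambda>_. UNIV"])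
    show "Int_stable E"
    proof (rule Int_stableI)
      fix S T assume "S \<in> E" "T \<in> E"
      then obtain us vs where "S = {x. \<forall>(u, r)\<in>set us. inner u x \<le> r}"
        "T = {x. \<forall>(u, r)\<in>set vs. inner u x \<le> r}" by (auto simp: E_def)
      then have "S \<inter> T = {x. \<forall>(u, r)\<in>set (us @ vs). inner u x \<le> r}" by auto
      then show "S \<inter> T \<in> E" unfolding E_def by blast
    qed
    show "emeasure \<mu> S = emeasure \<nu> S" if "S \<in> E" for S
    proof -
      have "good S" by (rule good_E[OF that])
      then have "(\<integral>x. indicator S x \<partial>\<mu>) = (\<integral>x. indicator S x \<partial>\<nu> :: real)"
        unfolding good_def by (metis (no_types, lifting) Bochner_Integration.integral_cong cos_zero inner_zero_left mult.right_neutral)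
      then show ?thesis by (simp add: space \<mu>.emeasure_eq_measure \<nu>.emeasure_eq_measure)
    qed
    show "range (\<lambda>_. UNIV) \<subseteq> E" unfolding E_def by (auto intro!: range_eqI[of _ _ "[]"])
  qed (auto simp: sets_\<mu> sets_\<nu> sets_borel_E)
qed

lemma centered_normal_variance:
  assumes "0 \<le> \<sigma>"
  shows "(\<integral>y. y\<^sup>2 \<partial>centered_normal \<sigma>) = \<sigma>\<^sup>2"
proof (cases "\<sigma> = 0")
  case True
  then show ?thesis by (simp add: centered_normal_def integral_return)
next
  case False
  with assms have "0 < \<sigma>" by simp
  have "(\<integral>y. y\<^sup>2 \<partial>density lborel (normal_density 0 \<sigma>)) = (\<integral>y. normal_density 0 \<sigma> y * y\<^sup>2 \<partial>lborel)"
    by (subst integral_density) auto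
  also have "\<dots> = \<sigma>\<^sup>2"
    using integral_normal_moment_even[OF \<open>0 < \<sigma>\<close>, of 0 1] by (simp add: fact_numeral)
  finally show ?thesis using False by (simp add: centered_normal_def)
qed

text \<open>
  The covariance determines the variance of every one-dimensional marginal, hence all marginals.
\<close>

lemma centered_gaussian_eqI:
  assumes \<mu>: "centered_gaussian \<mu>" "has_covariance \<mu> C" and \<nu>: "centered_gaussian \<nu>" "has_covariance \<nu> C"
  shows "\<mu> = \<nu>"
proof (rule measure_eqI_inner_distr)
  have marginal: "\<exists>\<sigma>\<ge>0. distr \<rho> borel (inner u) = centered_normal \<sigma> \<and> \<sigma>\<^sup>2 = inner u (C u)"
    if \<rho>: "centered_gaussian \<rho>" "has_covariance \<rho> C" for \<rho> u
  proof -
    have [measurable_cong]: "sets \<rho> = sets borel" using \<rho> by (simp add: centered_gaussian_def)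
    obtain \<sigma> where \<sigma>: "0 \<le> \<sigma>" "distr \<rho> borel (inner u) = centered_normal \<sigma>"
      using \<rho> by (auto simp: centered_gaussian_def)
    have "inner u (C u) = (\<integral>x. (inner u x)\<^sup>2 \<partial>\<rho>)"
      using \<rho> by (simp add: has_covariance_def power2_eq_square)
    also have "\<dots> = (\<integral>y. y\<^sup>2 \<partial>distr \<rho> borel (inner u))"
      by (subst integral_distr) auto
    also have "\<dots> = \<sigma>\<^sup>2" by (simp add: \<sigma> centered_normal_variance)
    finally show ?thesis using \<sigma> by auto
  qed
  fix u
  obtain \<sigma> \<tau> where "0 \<le> \<sigma>" "distr \<mu> borel (inner u) = centered_normal \<sigma>" "\<sigma>\<^sup>2 = inner u (C u)"
    and "0 \<le> \<tau>" "distr \<nu> borel (inner u) = centered_normal \<tau>" "\<tau>\<^sup>2 = inner u (C u)"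
    using marginal[OF \<mu>, of u] marginal[OF \<nu>, of u] by auto
  moreover from this have "\<sigma> = \<tau>" using power2_eq_iff_nonneg by metis
  ultimately show "distr \<mu> borel (inner u) = distr \<nu> borel (inner u)" by simp
qed (use \<mu> \<nu> in \<open>auto simp: centered_gaussian_def\<close>)

section \<open>Measurability of the kernel sections\<close>

text \<open>
  The classical argument for the projection theorem: the parallelogram law makes a minimising sequence
  for the distance to \<open>V\<close> a Cauchy sequence, and the residual at its limit is orthogonal to \<open>V\<close>.
\<close>

lemma exists_orthogonal_to_closed_subspace:
  fixes V :: "'h::{real_inner, banach} set"
  assumes V: "subspace V" "closed V" and f: "f \<notin> V"
  obtains g where "g \<noteq> 0" "\<And>v. v \<in> V \<Longrightarrow> inner g v = 0"
proof -
  define d where "d = infdist f V"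
  have "0 \<in> V" using V(1) by (rule subspace_0)
  then have ne: "V \<noteq> {}" by auto
  have d_le: "d \<le> norm (f - v)" if "v \<in> V" for v
    using infdist_le[OF that, of f] by (simp add: d_def dist_norm)
  have d0: "0 \<le> d" by (simp add: d_def infdist_nonneg)
  have "\<exists>v\<in>V. (norm (f - v))\<^sup>2 < d\<^sup>2 + inverse (real (Suc m))" for m
  proof -
    have "sqrt (d\<^sup>2) < sqrt (d\<^sup>2 + inverse (real (Suc m)))" by (rule real_sqrt_less_mono) simp
    then have "(INF v\<in>V. dist f v) < sqrt (d\<^sup>2 + inverse (real (Suc m)))"
      using d0 ne by (simp add: d_def infdist_notempty)
    then obtain v where "v \<in> V" "dist f v < sqrt (d\<^sup>2 + inverse (real (Suc m)))"
      using cInf_lessD[of "dist f ` V"] ne by blast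
    then have "(norm (f - v))\<^sup>2 < (sqrt (d\<^sup>2 + inverse (real (Suc m))))\<^sup>2"
      unfolding dist_norm by (intro power_strict_mono) auto
    then show ?thesis using \<open>v \<in> V\<close> by (auto simp: add_nonneg_nonneg)
  qed
  then obtain v where v: "\<And>m. v m \<in> V" "\<And>m. (norm (f - v m))\<^sup>2 < d\<^sup>2 + inverse (real (Suc m))"
    by metis
  have parallelogram: "(norm (x - y))\<^sup>2 \<le> 2 * (norm (f - x))\<^sup>2 + 2 * (norm (f - y))\<^sup>2 - 4 * d\<^sup>2"
    if "x \<in> V" "y \<in> V" for x y
  proof -
    have "(1/2) *\<^sub>R (x + y) \<in> V" using V(1) that by (intro subspace_scale subspace_add)
    then have "d\<^sup>2 \<le> (norm (f - (1/2) *\<^sub>R (x + y)))\<^sup>2" using d0 d_le by (intro power_mono)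
    moreover have "4 * (norm (f - (1/2) *\<^sub>R (x + y)))\<^sup>2
        = 2 * (norm (f - x))\<^sup>2 + 2 * (norm (f - y))\<^sup>2 - (norm (x - y))\<^sup>2"
      unfolding power2_norm_eq_inner by (simp add: algebra_simps inner_commute)
    ultimately show ?thesis by linarith
  qed
  have "Cauchy v"
  proof (rule metric_CauchyI)
    fix e :: real assume "0 < e"
    then obtain N where N: "inverse (real (Suc N)) < e\<^sup>2 / 4"
      using reals_Archimedean[of "e\<^sup>2 / 4"] by auto
    have "dist (v m) (v p) < e" if "m \<ge> N" "p \<ge> N" for m p
    proof -
      have "inverse (real (Suc q)) < e\<^sup>2 / 4" if "q \<ge> N" for q
        using N that by (smt (verit) inverse_le_imp_le of_nat_0_less_iff of_nat_mono Suc_le_mono zero_less_Suc le_imp_inverse_le)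
      from this[OF that(1)] this[OF that(2)] have "(norm (v m - v p))\<^sup>2 < e\<^sup>2"
        using parallelogram[OF v(1) v(1), of m p] v(2)[of m] v(2)[of p] by linarith
      then show ?thesis
        using \<open>0 < e\<close> by (simp add: dist_norm power_less_imp_less_base)
    qed
    then show "\<exists>N. \<forall>m\<ge>N. \<forall>p\<ge>N. dist (v m) (v p) < e" by blast
  qed
  then obtain l where l: "v \<longlonglongrightarrow> l" using Cauchy_convergent_iff convergentD by blast
  have lV: "l \<in> V" using closed_sequentially[OF V(2)] v l by blast
  have f_l: "(norm (f - l))\<^sup>2 \<le> d\<^sup>2"
  proof (rule LIMSEQ_le)
    show "(\<lambda>m. (norm (f - v m))\<^sup>2) \<longlonglongrightarrow> (norm (f - l))\<^sup>2" by (intro tendsto_intros l)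
    show "(\<lambda>m. d\<^sup>2 + inverse (real (Suc m))) \<longlonglongrightarrow> d\<^sup>2"
      using tendsto_add[OF tendsto_const LIMSEQ_inverse_real_of_nat, of "d\<^sup>2"] by simp
  qed (use v(2) less_imp_le in blast)
  show thesis
  proof (rule that)
    show "f - l \<noteq> 0" using f lV by auto
    fix u assume u: "u \<in> V"
    show "inner (f - l) u = 0"
    proof (cases "u = 0")
      case False
      define c where "c = inner (f - l) u"
      \<comment> \<open>The step along \<open>u\<close> that decreases the distance most.\<close>
      define t where "t = c / (norm u)\<^sup>2"
      have "l + t *\<^sub>R u \<in> V" using V(1) lV u by (intro subspace_scale subspace_add)
      then have "d\<^sup>2 \<le> (norm (f - (l + t *\<^sub>R u)))\<^sup>2" using d0 d_le by (intro power_mono)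
      also have "\<dots> = (norm (f - l))\<^sup>2 - 2 * t * c + t\<^sup>2 * (norm u)\<^sup>2"
        unfolding power2_norm_eq_inner c_def
        by (simp add: algebra_simps inner_commute power2_eq_square)
      finally have "2 * t * c \<le> t\<^sup>2 * (norm u)\<^sup>2" using f_l by linarith
      then have "c\<^sup>2 / (norm u)\<^sup>2 \<le> 0"
        using False by (simp add: t_def power2_eq_square)
      then have "c\<^sup>2 \<le> 0" using False by (simp add: divide_le_0_iff)
      then show ?thesis by (simp add: c_def)
    qed simp
  qed
qed

lemma kernel_section_eval:
  assumes "is_rkhs k eval_at"
  shows "eval_at (kernel_section eval_at k x) = k x"
    and "inner (kernel_section eval_at k x) (kernel_section eval_at k y) = k x y"
proof -
  show *: "eval_at (kernel_section eval_at k x) = k x"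
    using assms unfolding is_rkhs_def kernel_section_def by (metis f_inv_into_f)
  show "inner (kernel_section eval_at k x) (kernel_section eval_at k y) = k x y"
    using assms * unfolding is_rkhs_def by metis
qed

text \<open>
  The vectors \<open>f\<close> for which \<open>x \<mapsto> inner f (k_x)\<close> is measurable form a closed subspace.  It contains
  every \<open>k_y\<close> by measurability of the sections of the kernel, and a vector orthogonal to all \<open>k_y\<close>
  represents the zero function, so the subspace is everything.
\<close>

lemma measurable_kernel_section:
  fixes eval_at :: "'h::{real_inner, banach, second_countable_topology} \<Rightarrow> 's::topological_space \<Rightarrow> real"
  assumes rkhs: "is_rkhs k eval_at"
    and meas: "\<And>x. k x \<in> borel_measurable borel"
  shows "kernel_section eval_at k \<in> borel_measurable borel"
proof (rule measurable_of_inner)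
  let ?k = "kernel_section eval_at k"
  define V where "V = {f. (\<lambda>x. inner f (?k x)) \<in> borel_measurable borel}"
  have "subspace V"
    unfolding subspace_def V_def by (auto simp: inner_add_left)
  have "closed V"
    unfolding closed_sequential_limits
  proof (intro allI impI, elim conjE)
    fix f l assume f: "\<forall>m. f m \<in> V" "f \<longlonglongrightarrow> l"
    have "(\<lambda>x. inner l (?k x)) \<in> borel_measurable borel"
    proof (rule borel_measurable_LIMSEQ_real)
      show "(\<lambda>m. inner (f m) (?k x)) \<longlonglongrightarrow> inner l (?k x)" for x
        by (intro tendsto_intros f)
      show "(\<lambda>x. inner (f m) (?k x)) \<in> borel_measurable borel" for m
        using f by (simp add: V_def)
    qed
    then show "l \<in> V" by (simp add: V_def)
  qed
  have kV: "?k y \<in> V" for y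
    using meas[of y] by (simp add: V_def kernel_section_eval[OF rkhs])
  fix u
  have "u \<in> V"
  proof (rule ccontr)
    assume "u \<notin> V"
    then obtain g where g: "g \<noteq> 0" "\<And>v. v \<in> V \<Longrightarrow> inner g v = 0"
      using exists_orthogonal_to_closed_subspace[OF \<open>subspace V\<close> \<open>closed V\<close>] by blast
    have "eval_at g x = 0" for x
      using rkhs g(2)[OF kV[of x]] by (simp add: is_rkhs_def)
    moreover have "eval_at 0 x = 0" for x
      using rkhs unfolding is_rkhs_def by (metis inner_zero_left)
    ultimately have "eval_at g = eval_at 0" by auto
    then show False using rkhs g(1) by (auto simp: is_rkhs_def dest: injD)
  qed
  then show "(\<lambda>x. inner u (?k x)) \<in> borel_measurable borel" by (simp add: V_def)
qed

section \<open>Measurability of the ridge estimator\<close>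

text \<open>
  The step of gradient descent for the normal equation \<open>A f + l f = c\<close> is a contraction: with
  \<open>v = (A + l) u\<close>, monotonicity gives \<open>inner u v \<ge> l (norm u)\<^sup>2\<close> and boundedness gives
  \<open>norm v \<le> (b + l) norm u\<close>, and the step size \<open>l / (b + l)\<^sup>2\<close> minimises the resulting upper bound for
  \<open>(norm (u - \<tau> v))\<^sup>2\<close>.
\<close>

lemma ridge_gradient_step_contraction:
  fixes A :: "'h::real_inner \<Rightarrow> 'h"
  assumes lin: "linear A" and mono: "\<And>f. 0 \<le> inner f (A f)" and bound: "\<And>f. norm (A f) \<le> b * norm f"
    and l: "0 < l" and b: "0 \<le> b"
  defines "\<tau> \<equiv> l / (b + l)\<^sup>2"
  shows "dist (f - \<tau> *\<^sub>R (A f + l *\<^sub>R f - c)) (g - \<tau> *\<^sub>R (A g + l *\<^sub>R g - c))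
           \<le> sqrt (1 - l\<^sup>2 / (b + l)\<^sup>2) * dist f g"
proof -
  define u where "u = f - g"
  define v where "v = A u + l *\<^sub>R u"
  have bl: "0 < b + l" using l b by simp
  have "norm v \<le> norm (A u) + l * norm u"
    unfolding v_def using l norm_triangle_ineq[of "A u" "l *\<^sub>R u"] by simp
  also have "\<dots> \<le> (b + l) * norm u" using bound[of u] by (simp add: algebra_simps)
  finally have "(norm v)\<^sup>2 \<le> ((b + l) * norm u)\<^sup>2" by (intro power_mono) auto
  then have v2: "(norm v)\<^sup>2 \<le> (b + l)\<^sup>2 * (norm u)\<^sup>2" by (simp add: power_mult_distrib)
  have uv: "l * (norm u)\<^sup>2 \<le> inner u v"
    using mono[of u] by (simp add: v_def inner_add_right power2_norm_eq_inner)
  have \<tau>: "0 \<le> \<tau>" using l by (simp add: \<tau>_def)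
  have "(norm (u - \<tau> *\<^sub>R v))\<^sup>2 = (norm u)\<^sup>2 - 2 * \<tau> * inner u v + \<tau>\<^sup>2 * (norm v)\<^sup>2"
    unfolding power2_norm_eq_inner by (simp add: algebra_simps inner_commute power2_eq_square)
  also have "\<dots> \<le> (norm u)\<^sup>2 - 2 * \<tau> * (l * (norm u)\<^sup>2) + \<tau>\<^sup>2 * ((b + l)\<^sup>2 * (norm u)\<^sup>2)"
    using mult_left_mono[OF uv, of "2 * \<tau>"] mult_left_mono[OF v2, of "\<tau>\<^sup>2"] \<tau> zero_le_power2[of \<tau>] by linarith
  also have "\<tau>\<^sup>2 * ((b + l)\<^sup>2 * (norm u)\<^sup>2) = \<tau> * (l * (norm u)\<^sup>2)"
  proof -
    have "\<tau> * (b + l)\<^sup>2 = l" using bl by (simp add: \<tau>_def)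
    then show ?thesis by (metis (no_types, opaque_lifting) mult.assoc power2_eq_square)
  qed
  also have "(norm u)\<^sup>2 - 2 * \<tau> * (l * (norm u)\<^sup>2) + \<tau> * (l * (norm u)\<^sup>2) = (1 - l\<^sup>2 / (b + l)\<^sup>2) * (norm u)\<^sup>2"
    by (simp add: \<tau>_def power2_eq_square algebra_simps)
  finally have "norm (u - \<tau> *\<^sub>R v) \<le> sqrt ((1 - l\<^sup>2 / (b + l)\<^sup>2) * (norm u)\<^sup>2)"
    by (rule real_le_rsqrt)
  moreover have "(f - \<tau> *\<^sub>R (A f + l *\<^sub>R f - c)) - (g - \<tau> *\<^sub>R (A g + l *\<^sub>R g - c)) = u - \<tau> *\<^sub>R v"
    by (simp add: u_def v_def linear_diff[OF lin] algebra_simps)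
  ultimately show ?thesis
    unfolding dist_norm by (simp only: real_sqrt_mult real_sqrt_abs abs_norm_cancel u_def)
qed

text \<open>
  Besides the existence of the fixed point, the convergence of the iterates is what transports
  measurability in a parameter to the fixed point.
\<close>

lemma contraction_iterates_converge:
  fixes \<Phi> :: "'a::complete_space \<Rightarrow> 'a"
  assumes c: "0 \<le> c" "c < 1" and contr: "\<And>x y. dist (\<Phi> x) (\<Phi> y) \<le> c * dist x y"
  shows "\<exists>x. \<Phi> x = x \<and> (\<lambda>m. (\<Phi> ^^ m) y) \<longlonglongrightarrow> x"
proof -
  obtain x where x: "\<Phi> x = x" using banach_fix_type[OF c] contr by blast
  have bound: "dist ((\<Phi> ^^ m) y) x \<le> c ^ m * dist y x" for m
  proof (induction m)
    case (Suc m)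
    have "dist (\<Phi> ((\<Phi> ^^ m) y)) x \<le> c * dist ((\<Phi> ^^ m) y) x" using contr[of "(\<Phi> ^^ m) y" x] x by simp
    also have "\<dots> \<le> c * (c ^ m * dist y x)" using Suc c by (intro mult_left_mono)
    finally show ?case by simp
  qed simp
  have null: "(\<lambda>m. c ^ m * dist y x) \<longlonglongrightarrow> 0"
    using c by (intro tendsto_mult_left_zero LIMSEQ_power_zero) simp
  have "(\<lambda>m. dist ((\<Phi> ^^ m) y) x) \<longlonglongrightarrow> 0"
    by (rule tendsto_sandwich[OF always_eventually always_eventually tendsto_const null])
      (simp_all add: bound)
  then have "(\<lambda>m. (\<Phi> ^^ m) y) \<longlonglongrightarrow> x" by (rule tendsto_dist_iff[THEN iffD2])
  with x show ?thesis by blast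
qed

text \<open>
  Completing the square: around a solution \<open>f\<close> of the normal equation the objective equals its value at \<open>f\<close>
  plus a nonnegative quadratic form plus \<open>l (norm (g - f))\<^sup>2\<close>, so \<open>f\<close> is the only minimiser and the
  choice made by \<open>arg_min\<close> is forced.
\<close>

lemma f_hat_eqI:
  fixes eval_at :: "'h::{real_inner, banach, second_countable_topology} \<Rightarrow> 's \<Rightarrow> real"
  assumes rkhs: "is_rkhs k eval_at" and l: "0 < l"
    and normal_eq: "emp_operator k eval_at n d f + l *\<^sub>R f
      = (1 / real n) *\<^sub>R (\<Sum>i<n. snd (d i) *\<^sub>R kernel_section eval_at k (fst (d i)))"
  shows "f_hat eval_at n d l = f"
proof -
  let ?k = "\<lambda>i. kernel_section eval_at k (fst (d i))"
  define J where "J f = (1 / real n) * (\<Sum>i<n. (snd (d i) - eval_at f (fst (d i)))\<^sup>2) + l * (norm f)\<^sup>2" for f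
  have ev: "eval_at f x = inner f (kernel_section eval_at k x)" for f x
    using rkhs by (simp add: is_rkhs_def)
  have J_expand: "J g = J f + (1 / real n) * (\<Sum>i<n. (inner (g - f) (?k i))\<^sup>2) + l * (norm (g - f))\<^sup>2" for g
  proof -
    have sq: "(snd (d i) - inner g (?k i))\<^sup>2 = (snd (d i) - inner f (?k i))\<^sup>2
        - 2 * ((snd (d i) - inner f (?k i)) * inner (g - f) (?k i)) + (inner (g - f) (?k i))\<^sup>2" for i
      by (simp add: power2_eq_square inner_diff_left algebra_simps)
    have nrm: "(norm g)\<^sup>2 = (norm f)\<^sup>2 + 2 * inner f (g - f) + (norm (g - f))\<^sup>2"
      unfolding power2_norm_eq_inner by (simp add: algebra_simps inner_commute)
    have "inner (emp_operator k eval_at n d f + l *\<^sub>R f) (g - f)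
        = inner ((1 / real n) *\<^sub>R (\<Sum>i<n. snd (d i) *\<^sub>R ?k i)) (g - f)"
      by (simp only: normal_eq)
    then have "(1 / real n) * (\<Sum>i<n. inner (?k i) f * inner (?k i) (g - f)) + l * inner f (g - f)
        = (1 / real n) * (\<Sum>i<n. snd (d i) * inner (?k i) (g - f))"
      by (simp add: emp_operator_def rank_one_def inner_add_left inner_sum_left)
    then have cross: "(1 / real n) * (\<Sum>i<n. (snd (d i) - inner f (?k i)) * inner (g - f) (?k i)) = l * inner f (g - f)"
      by (simp add: left_diff_distrib sum_subtractf right_diff_distrib inner_commute)
    have arith: "p * (s - 2 * t + u) + l * (x + 2 * y + z) = p * s + l * x + p * u + l * z"
      if "p * t = l * y" for p s t u x y z :: real
      using that by algebra
    have sums: "(\<Sum>i<n. (snd (d i) - inner g (?k i))\<^sup>2) = (\<Sum>i<n. (snd (d i) - inner f (?k i))\<^sup>2)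
        - 2 * (\<Sum>i<n. (snd (d i) - inner f (?k i)) * inner (g - f) (?k i)) + (\<Sum>i<n. (inner (g - f) (?k i))\<^sup>2)"
      unfolding sq by (simp only: sum.distrib sum_subtractf sum_distrib_left)
    have "J g = (1 / real n) * (\<Sum>i<n. (snd (d i) - inner g (?k i))\<^sup>2) + l * (norm g)\<^sup>2"
      by (simp only: J_def ev)
    also have "\<dots> = (1 / real n) * (\<Sum>i<n. (snd (d i) - inner f (?k i))\<^sup>2) + l * (norm f)\<^sup>2
        + (1 / real n) * (\<Sum>i<n. (inner (g - f) (?k i))\<^sup>2) + l * (norm (g - f))\<^sup>2"
      unfolding sums nrm by (rule arith[OF cross])
    also have "(1 / real n) * (\<Sum>i<n. (snd (d i) - inner f (?k i))\<^sup>2) + l * (norm f)\<^sup>2 = J f"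
      by (simp only: J_def ev)
    finally show ?thesis .
  qed
  have J_less: "J f < J g" if "g \<noteq> f" for g
  proof -
    have "0 \<le> (1 / real n) * (\<Sum>i<n. (inner (g - f) (?k i))\<^sup>2)" by (simp add: sum_nonneg)
    moreover have "0 < l * (norm (g - f))\<^sup>2" using l that by simp
    ultimately show ?thesis unfolding J_expand[of g] by linarith
  qed
  have "is_arg_min J (\<lambda>_. True) g \<longleftrightarrow> g = f" for g
    using J_less unfolding is_arg_min_def by (metis less_irrefl less_trans)
  then have "is_arg_min J (\<lambda>_. True) = (\<lambda>g. g = f)" by auto
  then show ?thesis
    unfolding f_hat_def arg_min_def J_def[symmetric] by simp
qed

text \<open>
  The iterates of gradient descent from \<open>0\<close> are measurable functions of the sample.  Because the kernel is
  bounded by \<open>\<kappa>\<^sup>2\<close>, one step size makes the step a contraction for every sample, and the pointwise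
  limit is the ridge estimator.
\<close>

lemma measurable_f_hat:
  fixes eval_at :: "'h::{real_inner, banach, second_countable_topology} \<Rightarrow> 's::polish_space \<Rightarrow> real"
  assumes rkhs: "is_rkhs k eval_at"
    and meas: "\<And>x. k x \<in> borel_measurable borel" and bound: "\<And>x y. k x y \<le> \<kappa>\<^sup>2"
    and D: "\<And>i. i < n \<Longrightarrow> D i \<in> borel_measurable M" and l: "0 < l"
  shows "(\<lambda>w. f_hat eval_at n (\<lambda>i. D i w) l) \<in> borel_measurable M"
proof -
  let ?k = "kernel_section eval_at k"
  define A where "A w = emp_operator k eval_at n (\<lambda>i. D i w)" for w
  define c where "c w = (1 / real n) *\<^sub>R (\<Sum>i<n. snd (D i w) *\<^sub>R ?k (fst (D i w)))" for w
  \<comment> \<open>\<open>\<kappa>\<^sup>2\<close> bounds the operator norm of \<open>A w\<close> uniformly in \<open>w\<close>.\<close>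
  define \<tau> where "\<tau> = l / (\<kappa>\<^sup>2 + l)\<^sup>2"
  define \<Phi> where "\<Phi> w f = f - \<tau> *\<^sub>R (A w f + l *\<^sub>R f - c w)" for w f
  have km[measurable]: "?k \<in> borel_measurable borel"
    by (rule measurable_kernel_section[OF rkhs meas])
  have Dm: "(\<lambda>w. fst (D i w)) \<in> borel_measurable M" "(\<lambda>w. snd (D i w)) \<in> borel_measurable M" if "i < n" for i
    using D[OF that] borel_measurable_continuous_onI[OF continuous_on_fst[OF continuous_on_id]]
      borel_measurable_continuous_onI[OF continuous_on_snd[OF continuous_on_id]]
    by (auto intro: measurable_compose)
  have kDm: "(\<lambda>w. ?k (fst (D i w))) \<in> borel_measurable M" if "i < n" for i
    by (rule measurable_compose[OF Dm(1)[OF that] km])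
  have norm_k: "(norm (?k x))\<^sup>2 \<le> \<kappa>\<^sup>2" for x
    using bound[of x x] by (simp add: power2_norm_eq_inner kernel_section_eval[OF rkhs])
  have A_eq: "A w f = (1 / real n) *\<^sub>R (\<Sum>i<n. inner (?k (fst (D i w))) f *\<^sub>R ?k (fst (D i w)))" for w f
    by (simp add: A_def emp_operator_def rank_one_def)
  have lin: "linear (A w)" for w
    by (rule linearI) (simp_all add: A_eq inner_add_right scaleR_add_left sum.distrib scaleR_add_right scaleR_sum_right mult.left_commute mult.commute)
  have mono: "0 \<le> inner f (A w f)" for w f
    by (simp add: A_eq inner_sum_right inner_commute sum_nonneg)
  have bnd: "norm (A w f) \<le> \<kappa>\<^sup>2 * norm f" for w f
  proof -
    have "norm (A w f) \<le> (1 / real n) * (\<Sum>i<n. norm (inner (?k (fst (D i w))) f *\<^sub>R ?k (fst (D i w))))"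
      unfolding A_eq norm_scaleR[of "1 / real n"] by (intro mult_mono norm_sum) auto
    also have "\<dots> \<le> (1 / real n) * (\<Sum>i<n. \<kappa>\<^sup>2 * norm f)"
    proof (intro mult_left_mono sum_mono)
      fix i
      let ?x = "fst (D i w)"
      have "norm (inner (?k ?x) f *\<^sub>R ?k ?x) \<le> (norm (?k ?x) * norm f) * norm (?k ?x)"
        by (simp add: mult_right_mono Cauchy_Schwarz_ineq2)
      also have "\<dots> = (norm (?k ?x))\<^sup>2 * norm f" by (simp add: power2_eq_square)
      also have "\<dots> \<le> \<kappa>\<^sup>2 * norm f" using norm_k by (intro mult_right_mono) auto
      finally show "norm (inner (?k ?x) f *\<^sub>R ?k ?x) \<le> \<kappa>\<^sup>2 * norm f" .
    qed simp
    also have "\<dots> \<le> \<kappa>\<^sup>2 * norm f" by simp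
    finally show ?thesis .
  qed
  let ?q = "sqrt (1 - l\<^sup>2 / (\<kappa>\<^sup>2 + l)\<^sup>2)"
  have "l\<^sup>2 \<le> (\<kappa>\<^sup>2 + l)\<^sup>2" using l by (intro power_mono) auto
  then have "0 < l\<^sup>2 / (\<kappa>\<^sup>2 + l)\<^sup>2" "l\<^sup>2 / (\<kappa>\<^sup>2 + l)\<^sup>2 \<le> 1"
    using l by (auto simp: divide_le_eq_1 intro!: divide_pos_pos zero_less_power add_nonneg_pos)
  then have q: "0 \<le> ?q" "?q < 1" by auto
  have lim: "(\<lambda>m. (\<Phi> w ^^ m) 0) \<longlonglongrightarrow> f_hat eval_at n (\<lambda>i. D i w) l" for w
  proof -
    have "dist (\<Phi> w f) (\<Phi> w g) \<le> ?q * dist f g" for f g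
      unfolding \<Phi>_def \<tau>_def
      by (rule ridge_gradient_step_contraction[OF lin mono bnd l]) simp
    from contraction_iterates_converge[OF q this, of 0]
    obtain f where f: "\<Phi> w f = f" "(\<lambda>m. (\<Phi> w ^^ m) 0) \<longlonglongrightarrow> f" by blast
    have "0 < \<kappa>\<^sup>2 + l" using l by (intro add_nonneg_pos) auto
    then have "\<tau> \<noteq> 0" using l by (simp add: \<tau>_def)
    then have "A w f + l *\<^sub>R f = c w" using f(1) by (simp add: \<Phi>_def)
    then have "f_hat eval_at n (\<lambda>i. D i w) l = f"
      unfolding A_def c_def by (intro f_hat_eqI[OF rkhs l])
    with f show ?thesis by simp
  qed
  have "(\<lambda>w. (\<Phi> w ^^ m) 0) \<in> borel_measurable M" for m
  proof (induction m)
    case (Suc m)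
    then show ?case
      unfolding funpow.simps comp_def \<Phi>_def A_eq c_def
      using Dm kDm by (auto intro!: borel_measurable_diff borel_measurable_add borel_measurable_scaleR
          borel_measurable_sum borel_measurable_inner borel_measurable_const)
  qed simp
  then show ?thesis
    using lim by (rule borel_measurable_LIMSEQ_metric)
qed

section \<open>Couplings and distribution functions, with and without conditioning\<close>

lemma with_prob_at_least_AE_mono:
  assumes A: "with_prob_at_least M p A" and AB: "AE w in M. A w \<longrightarrow> B w"
  shows "with_prob_at_least M p B"
proof -
  obtain E where E: "E \<in> sets M" "p \<le> measure M E" "\<And>w. w \<in> E \<Longrightarrow> A w"
    using A by (auto simp: with_prob_at_least_def)
  obtain N where N: "N \<in> null_sets M" "{w \<in> space M. \<not> (A w \<longrightarrow> B w)} \<subseteq> N"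
    using AB by (auto simp: eventually_ae_filter)
  have "measure M (E - N) = measure M E"
    using E N by (simp add: measure_Diff_null_set)
  moreover have "B w" if "w \<in> E - N" for w
    using that E N sets.sets_into_space[OF E(1)] by blast
  ultimately show ?thesis
    using E N unfolding with_prob_at_least_def by (intro bexI[of _ "E - N"]) auto
qed

lemma with_prob_at_least_pos_witness:
  assumes "with_prob_at_least M p A" "0 < p"
  shows "\<exists>w\<in>space M. A w"
proof -
  obtain E where E: "E \<in> sets M" "p \<le> measure M E" "\<And>w. w \<in> E \<Longrightarrow> A w"
    using assms by (auto simp: with_prob_at_least_def)
  then have "E \<noteq> {}" using assms(2) by auto
  then show ?thesis using E sets.sets_into_space by blast
qed

text \<open>
  Failure of an event that need not be measurable is confined to a measurable set of small
  probability; this form lets exceptional sets be added up.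
\<close>

lemma (in prob_space) with_prob_at_least_compl:
  assumes "with_prob_at_least M (1 - \<eta>) A"
  obtains E where "E \<in> sets M" "prob E \<le> \<eta>" "\<And>w. w \<in> space M - E \<Longrightarrow> A w"
proof -
  obtain E where E: "E \<in> sets M" "1 - \<eta> \<le> prob E" "\<And>w. w \<in> E \<Longrightarrow> A w"
    using assms by (auto simp: with_prob_at_least_def)
  show thesis
    by (rule that[of "space M - E"]) (use E in \<open>auto simp: prob_compl\<close>)
qed

lemma (in prob_space) prob_le_of_exceptional:
  assumes sets: "S \<in> sets M" "T \<in> sets M" "E \<in> sets M"
    and imp: "\<And>w. w \<in> S \<Longrightarrow> w \<notin> E \<Longrightarrow> w \<in> T" and E: "prob E \<le> e"
  shows "prob S \<le> prob T + e"
proof -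
  have "prob S \<le> prob (T \<union> E)"
    using sets imp by (intro finite_measure_mono) auto
  also have "\<dots> \<le> prob T + prob E"
    using sets by (intro measure_Un_le)
  finally show ?thesis using E by simp
qed

text \<open>
  This is where concentration enters: moving the argument of a distribution function by \<open>r\<close> costs at
  most the probability of being within \<open>r\<close> of \<open>t\<close>.
\<close>

lemma (in prob_space) cdf_increment_le_concentration:
  fixes Y :: "'a \<Rightarrow> real"
  assumes [measurable]: "Y \<in> borel_measurable M"
  shows "prob {w \<in> space M. Y w \<le> t + r} \<le> prob {w \<in> space M. Y w \<le> t} + prob {w \<in> space M. \<bar>Y w - t\<bar> \<le> r}"
    and "prob {w \<in> space M. Y w \<le> t} \<le> prob {w \<in> space M. Y w \<le> t - r} + prob {w \<in> space M. \<bar>Y w - t\<bar> \<le> r}"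
proof -
  have le[measurable]: "{w \<in> space M. Y w \<le> x} \<in> sets M" for x by measurable
  have near: "{w \<in> space M. \<bar>Y w - t\<bar> \<le> r} \<in> sets M" by measurable
  show "prob {w \<in> space M. Y w \<le> t + r} \<le> prob {w \<in> space M. Y w \<le> t} + prob {w \<in> space M. \<bar>Y w - t\<bar> \<le> r}"
    and "prob {w \<in> space M. Y w \<le> t} \<le> prob {w \<in> space M. Y w \<le> t - r} + prob {w \<in> space M. \<bar>Y w - t\<bar> \<le> r}"
    by (rule prob_le_of_exceptional[OF le le near _ order_refl]; auto)+
qed

lemma (in prob_space) cdf_sandwich_of_coupling:
  fixes X Y :: "'a \<Rightarrow> 'b::{real_normed_vector, second_countable_topology}" and F :: "'b \<Rightarrow> real"
  assumes [measurable]: "X \<in> borel_measurable M" "Y \<in> borel_measurable M" "F \<in> borel_measurable borel"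
    and near: "with_prob_at_least M (1 - \<eta>) (\<lambda>w. norm (X w - Y w) \<le> r)"
    and F: "\<forall>u v. norm (u - v) \<le> r \<longrightarrow> \<bar>F u - F v\<bar> \<le> s"
  shows "prob {w \<in> space M. F (X w) \<le> t} \<le> prob {w \<in> space M. F (Y w) \<le> t + s} + \<eta>"
    and "prob {w \<in> space M. F (Y w) \<le> t - s} \<le> prob {w \<in> space M. F (X w) \<le> t} + \<eta>"
proof -
  obtain E where E: "E \<in> sets M" "prob E \<le> \<eta>" "\<And>w. w \<in> space M - E \<Longrightarrow> norm (X w - Y w) \<le> r"
    using with_prob_at_least_compl[OF near] by blast
  have "\<bar>F (X w) - F (Y w)\<bar> \<le> s" if "w \<in> space M" "w \<notin> E" for w
    using that E F by blast
  note close = this[unfolded abs_le_iff]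
  have FX: "{w \<in> space M. F (X w) \<le> x} \<in> sets M" and FY: "{w \<in> space M. F (Y w) \<le> x} \<in> sets M" for x
    by measurable
  show "prob {w \<in> space M. F (X w) \<le> t} \<le> prob {w \<in> space M. F (Y w) \<le> t + s} + \<eta>"
    and "prob {w \<in> space M. F (Y w) \<le> t - s} \<le> prob {w \<in> space M. F (X w) \<le> t} + \<eta>"
    using close by (auto intro!: prob_le_of_exceptional[OF FX FY E(1) _ E(2)]
        prob_le_of_exceptional[OF FY FX E(1) _ E(2)]) force+
qed

text \<open>
  The inequality \<open>1 [X \<in> A] + 1 [C] \<le> 1 [Y \<in> A'] + 1\<close> between indicators, after taking conditional
  expectations.  The exceptional null set depends on \<open>A\<close> and \<open>A'\<close>.
\<close>

lemma cond_distr_le_of_coupling: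
  fixes X :: "'w \<Rightarrow> 'a" and Y :: "'w \<Rightarrow> 'b"
  assumes sub: "finite_measure_subalgebra M G"
    and X: "regular_cond_distr M G N X KX" and Y: "regular_cond_distr M G N' Y KY"
    and A: "A \<in> sets N" and A': "A' \<in> sets N'" and C: "C \<in> sets M"
    and imp: "\<And>w. w \<in> C \<Longrightarrow> X w \<in> A \<Longrightarrow> Y w \<in> A'"
  shows "AE w in M. measure (KX w) A + real_cond_exp M G (indicator C) w \<le> measure (KY w) A' + 1"
proof -
  interpret finite_measure_subalgebra M G by fact
  have [measurable]: "X \<in> measurable M N" "Y \<in> measurable M N'" "A \<in> sets N" "A' \<in> sets N'" "C \<in> sets M"
    using X Y A A' C by (auto simp: regular_cond_distr_def)
  let ?X = "indicator {w \<in> space M. X w \<in> A} :: 'w \<Rightarrow> real"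
  let ?Y = "indicator {w \<in> space M. Y w \<in> A'} :: 'w \<Rightarrow> real"
  let ?C = "indicator C :: 'w \<Rightarrow> real"
  have int: "integrable M ?X" "integrable M ?Y" "integrable M ?C" "integrable M (\<lambda>_. 1 :: real)"
    by (auto simp: integrable_indicator_iff emeasure_eq_measure)
  have "?X w + ?C w \<le> ?Y w + 1" for w
    using imp[of w] sets.sets_into_space[OF C] by (auto simp: indicator_def)
  then have "AE w in M. real_cond_exp M G (\<lambda>w. ?X w + ?C w) w \<le> real_cond_exp M G (\<lambda>w. ?Y w + 1) w"
    using int by (intro real_cond_exp_mono) auto
  moreover have "AE w in M. real_cond_exp M G (\<lambda>w. ?X w + ?C w) w = real_cond_exp M G ?X w + real_cond_exp M G ?C w"
    using int by (intro real_cond_exp_add)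
  moreover have "AE w in M. real_cond_exp M G (\<lambda>w. ?Y w + 1) w = real_cond_exp M G ?Y w + real_cond_exp M G (\<lambda>_. 1) w"
    using int by (intro real_cond_exp_add)
  moreover have "AE w in M. real_cond_exp M G (\<lambda>_. 1) w = 1"
    using int by (intro real_cond_exp_F_meas) auto
  moreover have "AE w in M. measure (KX w) A = real_cond_exp M G ?X w"
    using X A by (simp add: regular_cond_distr_def)
  moreover have "AE w in M. measure (KY w) A' = real_cond_exp M G ?Y w"
    using Y A' by (simp add: regular_cond_distr_def)
  ultimately show ?thesis by eventually_elim linarith
qed

text \<open>
  Right-continuity of distribution functions: a lower bound at all rational points to the right passes to
  the limit.  It extends almost sure inequalities from countably many arguments to all of them.
\<close>

lemma cdf_ge_of_rational:
  fixes F :: "'b \<Rightarrow> real"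
  assumes "finite_measure \<nu>" and F: "F \<in> borel_measurable \<nu>"
    and ge: "\<And>q. q \<in> \<rat> \<Longrightarrow> t < q \<Longrightarrow> c \<le> measure \<nu> {u \<in> space \<nu>. F u \<le> q + s}"
  shows "c \<le> measure \<nu> {u \<in> space \<nu>. F u \<le> t + s}"
proof -
  interpret finite_measure \<nu> by fact
  note [measurable] = F
  define S where "S m = {u \<in> space \<nu>. F u \<le> t + s + inverse (real (Suc m))}" for m
  have Sm: "S m \<in> sets \<nu>" for m unfolding S_def by measurable
  have lim: "(\<lambda>m. t + s + inverse (real (Suc m))) \<longlonglongrightarrow> t + s"
    using tendsto_add[OF tendsto_const LIMSEQ_inverse_real_of_nat, of "t + s"] by simp
  have "decseq S"
    unfolding decseq_def
  proof (intro allI impI)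
    fix m p :: nat assume "m \<le> p"
    then have "inverse (real (Suc p)) \<le> inverse (real (Suc m))" by (intro le_imp_inverse_le) auto
    then have "x \<le> t + s + inverse (real (Suc m))" if "x \<le> t + s + inverse (real (Suc p))" for x
      using that by linarith
    then show "S p \<subseteq> S m" unfolding S_def by blast
  qed
  then have "(\<lambda>m. measure \<nu> (S m)) \<longlonglongrightarrow> measure \<nu> (\<Inter>m. S m)"
    using Sm by (intro finite_Lim_measure_decseq) auto
  also have "(\<Inter>m. S m) = {u \<in> space \<nu>. F u \<le> t + s}"
  proof (intro equalityI subsetI)
    fix u assume u: "u \<in> (\<Inter>m. S m)"
    then have "F u \<le> t + s"
      by (intro LIMSEQ_le_const[OF lim]) (auto simp: S_def)
    then show "u \<in> {u \<in> space \<nu>. F u \<le> t + s}" using u by (auto simp: S_def)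
  qed (auto simp: S_def intro: add_increasing2)
  finally have "(\<lambda>m. measure \<nu> (S m)) \<longlonglongrightarrow> measure \<nu> {u \<in> space \<nu>. F u \<le> t + s}" .
  moreover have "c \<le> measure \<nu> (S m)" for m
  proof -
    obtain q where q: "q \<in> \<rat>" "t < q" "q < t + inverse (real (Suc m))"
      using Rats_dense_in_real[of t "t + inverse (real (Suc m))"] by auto
    have "c \<le> measure \<nu> {u \<in> space \<nu>. F u \<le> q + s}" by (rule ge[OF q(1,2)])
    also have "\<dots> \<le> measure \<nu> (S m)"
      using q(3) Sm by (intro finite_measure_mono) (auto simp: S_def)
    finally show ?thesis .
  qed
  ultimately show ?thesis by (intro LIMSEQ_le_const) auto
qed

lemma regular_cond_distr_prob_space:
  assumes "regular_cond_distr M G N X K" "w \<in> space G"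
  shows "prob_space (K w)" "sets (K w) = sets N"
  using assms measurable_space[of K G "prob_algebra N" w]
  by (auto simp: regular_cond_distr_def space_prob_algebra)

text \<open>
  For each fixed \<open>t\<close> the inequalities hold outside a null set.  One null set serves all rational
  \<open>t\<close>, and right-continuity of both conditional distribution functions extends the
  inequalities to real \<open>t\<close>, so that suprema over \<open>t\<close> can be taken afterwards.
\<close>

lemma cond_cdf_sandwich_of_coupling:
  fixes X Y :: "'w \<Rightarrow> 'b::{real_normed_vector, second_countable_topology}" and F :: "'b \<Rightarrow> real"
  assumes sub: "finite_measure_subalgebra M G"
    and X: "regular_cond_distr M G borel X KX" and Y: "regular_cond_distr M G borel Y KY"
    and F[measurable]: "F \<in> borel_measurable borel"
    and F_near: "\<forall>u v. norm (u - v) \<le> r \<longrightarrow> \<bar>F u - F v\<bar> \<le> s"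
  shows "AE w in M. 1 - \<eta> \<le> real_cond_exp M G (indicator {w' \<in> space M. norm (X w' - Y w') \<le> r}) w \<longrightarrow>
    (\<forall>t. measure (KX w) {u. F u \<le> t} \<le> measure (KY w) {u. F u \<le> t + s} + \<eta> \<and>
         measure (KY w) {u. F u \<le> t - s} \<le> measure (KX w) {u. F u \<le> t} + \<eta>)"
proof -
  interpret finite_measure_subalgebra M G by fact
  define C where "C = {w \<in> space M. norm (X w - Y w) \<le> r}"
  have [measurable]: "X \<in> borel_measurable M" "Y \<in> borel_measurable M"
    using X Y by (auto simp: regular_cond_distr_def)
  have C: "C \<in> sets M" unfolding C_def by measurable
  have C_near: "\<bar>F (X w) - F (Y w)\<bar> \<le> s" if "w \<in> C" for w
    using that F_near by (auto simp: C_def)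
  have le: "{u. F u \<le> x} \<in> sets borel" for x by measurable
  have "AE w in M. \<forall>q\<in>\<rat>. measure (KX w) {u. F u \<le> q} + real_cond_exp M G (indicator C) w
      \<le> measure (KY w) {u. F u \<le> q + s} + 1"
    using C_near by (intro AE_ball_countable'[OF cond_distr_le_of_coupling[OF sub X Y le le C]])
      (force simp: countable_rat abs_le_iff)+
  moreover have "AE w in M. \<forall>q\<in>\<rat>. measure (KY w) {u. F u \<le> q - s} + real_cond_exp M G (indicator C) w
      \<le> measure (KX w) {u. F u \<le> q} + 1"
    using C_near by (intro AE_ball_countable'[OF cond_distr_le_of_coupling[OF sub Y X le le C]])
      (force simp: countable_rat abs_le_iff)+
  ultimately show ?thesis
    using AE_space unfolding C_def[symmetric]
  proof eventually_elim
    fix w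
    assume le_X: "\<forall>q\<in>\<rat>. measure (KX w) {u. F u \<le> q} + real_cond_exp M G (indicator C) w
        \<le> measure (KY w) {u. F u \<le> q + s} + 1"
      and le_Y: "\<forall>q\<in>\<rat>. measure (KY w) {u. F u \<le> q - s} + real_cond_exp M G (indicator C) w
        \<le> measure (KX w) {u. F u \<le> q} + 1"
      and "w \<in> space M"
    then have w: "w \<in> space G" using subalg by (simp add: subalgebra_def)
    interpret KX: prob_space "KX w" by (rule regular_cond_distr_prob_space[OF X w])
    interpret KY: prob_space "KY w" by (rule regular_cond_distr_prob_space[OF Y w])
    have sets_K[measurable_cong]: "sets (KX w) = sets borel" "sets (KY w) = sets borel"
      using regular_cond_distr_prob_space(2)[OF X w] regular_cond_distr_prob_space(2)[OF Y w] by auto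
    have space_K: "space (KX w) = UNIV" "space (KY w) = UNIV"
      using sets_K[THEN sets_eq_imp_space_eq] by auto
    show "1 - \<eta> \<le> real_cond_exp M G (indicator C) w \<longrightarrow>
      (\<forall>t. measure (KX w) {u. F u \<le> t} \<le> measure (KY w) {u. F u \<le> t + s} + \<eta> \<and>
           measure (KY w) {u. F u \<le> t - s} \<le> measure (KX w) {u. F u \<le> t} + \<eta>)"
    proof (intro impI allI conjI)
      fix t
      assume good: "1 - \<eta> \<le> real_cond_exp M G (indicator C) w"
      have "measure (KX w) {u. F u \<le> t} - \<eta> \<le> measure (KY w) {u \<in> space (KY w). F u \<le> t + s}"
      proof (rule cdf_ge_of_rational)
        fix q :: real assume "q \<in> \<rat>" "t < q"
        have "measure (KX w) {u. F u \<le> t} \<le> measure (KX w) {u. F u \<le> q}"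
          using \<open>t < q\<close> by (intro KX.finite_measure_mono) auto
        then show "measure (KX w) {u. F u \<le> t} - \<eta> \<le> measure (KY w) {u \<in> space (KY w). F u \<le> q + s}"
          using le_X[rule_format, OF \<open>q \<in> \<rat>\<close>] good by (simp add: space_K)
      qed (rule KY.finite_measure_axioms, measurable)
      then show "measure (KX w) {u. F u \<le> t} \<le> measure (KY w) {u. F u \<le> t + s} + \<eta>"
        by (simp add: space_K)
      have "measure (KY w) {u. F u \<le> t - s} - \<eta> \<le> measure (KX w) {u \<in> space (KX w). F u \<le> t + 0}"
      proof (rule cdf_ge_of_rational)
        fix q :: real assume "q \<in> \<rat>" "t < q"
        have "measure (KY w) {u. F u \<le> t - s} \<le> measure (KY w) {u. F u \<le> q - s}"
          using \<open>t < q\<close> by (intro KY.finite_measure_mono) auto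
        then show "measure (KY w) {u. F u \<le> t - s} - \<eta> \<le> measure (KX w) {u \<in> space (KX w). F u \<le> q + 0}"
          using le_Y[rule_format, OF \<open>q \<in> \<rat>\<close>] good by (simp add: space_K)
      qed (rule KX.finite_measure_axioms, measurable)
      then show "measure (KY w) {u. F u \<le> t - s} \<le> measure (KX w) {u. F u \<le> t} + \<eta>"
        by (simp add: space_K)
    qed
  qed
qed

section \<open>Coverage of balls around the estimator\<close>

text \<open>
  For a data-dependent \<open>s\<close> the bound \<open>p \<le> P (Y \<le> s)\<close> says only that \<open>s\<close> is at least the
  \<open>p\<close>-quantile \<open>q\<close>.  Exceeding such an \<open>s\<close> forces \<open>Y > q\<close>, and one event of probability at most
  \<open>1 - p\<close> covers all choices of \<open>s\<close> simultaneously.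
\<close>

lemma (in prob_space) upper_quantile_event:
  fixes Y :: "'a \<Rightarrow> real"
  assumes Y[measurable]: "Y \<in> borel_measurable M" and p: "0 < p" "p \<le> 1"
  obtains E where "E \<in> sets M" "prob E \<le> 1 - p"
    "\<And>w s. w \<in> space M - E \<Longrightarrow> p \<le> prob {w \<in> space M. Y w \<le> s} \<Longrightarrow> Y w \<le> s"
proof -
  define H where "H s = prob {w \<in> space M. Y w \<le> s}" for s
  have H_mono: "H s \<le> H t" if "s \<le> t" for s t
    unfolding H_def using that by (intro finite_measure_mono) auto
  interpret D: real_distribution "distr M borel Y" by (rule real_distribution_distr) simp
  have cdf_H: "cdf (distr M borel Y) = H"
  proof
    fix s
    have "Y -` {..s} \<inter> space M = {w \<in> space M. Y w \<le> s}" by auto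
    then show "cdf (distr M borel Y) s = H s" by (simp add: cdf_def H_def measure_distr)
  qed
  define S where "S = {s. p \<le> H s}"
  show thesis
  proof (cases "S = {}")
    case True
    then show ?thesis using p by (intro that[of "{}"]) (auto simp: S_def H_def)
  next
    case False
    have bdd: "bdd_below S"
    proof (rule ccontr)
      assume unb: "\<not> bdd_below S"
      have "p \<le> H s" for s
      proof -
        obtain s' where "s' \<in> S" "s' < s" using unb unfolding bdd_below_def by (meson not_le)
        then show ?thesis using H_mono[of s' s] by (simp add: S_def)
      qed
      then have "p \<le> 0"
        using D.cdf_lim_at_bot unfolding cdf_H by (intro tendsto_lowerbound[of H 0 at_bot]) auto
      then show False using p by simp
    qed
    define q where "q = Inf S"
    have "p \<le> prob {w \<in> space M. Y w \<le> q + 0}"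
    proof (rule cdf_ge_of_rational[OF finite_measure_axioms Y])
      fix r assume "q < r"
      then obtain s where "s \<in> S" "s < r" using cInf_lessD[OF False] unfolding q_def by blast
      then show "p \<le> prob {w \<in> space M. Y w \<le> r + 0}" using H_mono[of s r] by (simp add: S_def H_def)
    qed
    moreover have "space M - {w \<in> space M. q < Y w} = {w \<in> space M. Y w \<le> q}" by auto
    moreover have "prob {w \<in> space M. q < Y w} = 1 - prob (space M - {w \<in> space M. q < Y w})"
      by (subst prob_compl) auto
    ultimately have "prob {w \<in> space M. q < Y w} \<le> 1 - p" by simp
    moreover have "q \<le> s" if "s \<in> S" for s using cInf_lower[OF that bdd] by (simp add: q_def)
    ultimately show ?thesis
      by (intro that[of "{w \<in> space M. q < Y w}"]) (force simp: S_def H_def not_less)+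
  qed
qed

text \<open>
  The counterpart from below.  The set of admissible \<open>s\<close> may or may not contain its supremum \<open>q\<close>; this
  decides whether \<open>{Y \<le> q}\<close> or \<open>{Y < q}\<close> is the event, and makes the statement valid for
  distributions with atoms.
\<close>

lemma (in prob_space) lower_quantile_event:
  fixes Y :: "'a \<Rightarrow> real"
  assumes Y[measurable]: "Y \<in> borel_measurable M" and p: "0 \<le> p"
  obtains E where "E \<in> sets M" "prob E \<le> p"
    "\<And>w s. w \<in> space M - E \<Longrightarrow> prob {w \<in> space M. Y w \<le> s} \<le> p \<Longrightarrow> s < Y w"
proof -
  define H where "H s = prob {w \<in> space M. Y w \<le> s}" for s
  have H_mono: "H s \<le> H t" if "s \<le> t" for s t
    unfolding H_def using that by (intro finite_measure_mono) auto
  interpret D: real_distribution "distr M borel Y" by (rule real_distribution_distr) simp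
  have cdf_H: "cdf (distr M borel Y) = H"
  proof
    fix s
    have "Y -` {..s} \<inter> space M = {w \<in> space M. Y w \<le> s}" by auto
    then show "cdf (distr M borel Y) s = H s" by (simp add: cdf_def H_def measure_distr)
  qed
  define S where "S = {s. H s \<le> p}"
  define q where "q = Sup S"
  consider "S = {}" | "S \<noteq> {}" "\<not> bdd_above S" | "S \<noteq> {}" "bdd_above S" "q \<in> S" | "S \<noteq> {}" "bdd_above S" "q \<notin> S"
    by argo
  then show thesis
  proof cases
    case 1
    then show ?thesis using p by (intro that[of "{}"]) (auto simp: S_def H_def)
  next
    case 2
    have "H s \<le> p" for s
    proof -
      obtain s' where "s' \<in> S" "s < s'" using 2 unfolding bdd_above_def by (meson not_le)
      then show ?thesis using H_mono[of s s'] by (simp add: S_def)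
    qed
    then have "1 \<le> p"
      using D.cdf_lim_at_top_prob unfolding cdf_H by (intro tendsto_upperbound[of H 1 at_top]) auto
    then show ?thesis by (intro that[of "space M"]) (auto simp: prob_space)
  next
    case 3
    then have "s \<le> q" if "s \<in> S" for s using cSup_upper[OF that] by (simp add: q_def)
    with 3 show ?thesis
      by (intro that[of "{w \<in> space M. Y w \<le> q}"]) (force simp: S_def H_def not_less)+
  next
    case 4
    \<comment> \<open>Left limits of the distribution function of \<open>Y\<close> are right limits for \<open>- Y\<close>.\<close>
    have "1 - p \<le> prob {w \<in> space M. - Y w \<le> - q + 0}"
    proof (rule cdf_ge_of_rational[OF finite_measure_axioms])
      fix r assume "- q < r"
      then have "- r < q" by simp
      then obtain s where "s \<in> S" "- r < s" using less_cSupD[OF 4(1)] unfolding q_def by blast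
      then have "H (- r) \<le> p" using H_mono[of "- r" s] by (simp add: S_def)
      moreover have "prob (space M - {w \<in> space M. Y w \<le> - r}) = 1 - H (- r)"
        unfolding H_def by (rule prob_compl) simp
      moreover have "prob (space M - {w \<in> space M. Y w \<le> - r}) \<le> prob {w \<in> space M. - Y w \<le> r + 0}"
        by (intro finite_measure_mono) auto
      ultimately show "1 - p \<le> prob {w \<in> space M. - Y w \<le> r + 0}" by linarith
    qed simp
    moreover have "{w \<in> space M. - Y w \<le> - q + 0} = space M - {w \<in> space M. Y w < q}" by auto
    moreover have "prob (space M - {w \<in> space M. Y w < q}) = 1 - prob {w \<in> space M. Y w < q}"
      by (rule prob_compl) simp
    ultimately have "prob {w \<in> space M. Y w < q} \<le> p" by simp
    moreover have "s < q" if "s \<in> S" for s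
      using cSup_upper[OF that 4(2)] 4(3) that by (cases "s = q") (auto simp: q_def)
    ultimately show ?thesis
      by (intro that[of "{w \<in> space M. Y w < q}"]) (force simp: S_def H_def not_less)+
  qed
qed

text \<open>
  Outside the exceptional sets \<open>T + R\<close> is at least the \<open>(1 - \<alpha> - \<eta>)\<close>-quantile of \<open>norm Z\<close>.  As
  \<open>norm Z \<ge> l\<close> holds with probability at least \<open>\<alpha> + 2 \<eta> > \<alpha> + \<eta>\<close>, that quantile is at least \<open>l\<close>,
  which gives \<open>T \<ge> l - R > 0\<close> and \<open>Q + R \<le> \<delta> T\<close>.  Hence \<open>norm Z \<le> T + R\<close> implies
  \<open>norm X \<le> T + R + Q \<le> (1 + \<delta>) T\<close>.  Conversely \<open>(1 - 2 \<delta>) (1 + \<delta>) \<le> 1 - \<delta>\<close>, so that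
  \<open>norm X \<le> (1 - 2 \<delta>) (1 + \<delta>) T\<close> implies \<open>norm Z \<le> (1 - \<delta>) T + Q \<le> T - R\<close>, an event controlled by
  the \<open>(1 - \<alpha> + \<eta>)\<close>-quantile.
\<close>

lemma (in prob_space) coverage_of_coupling:
  fixes X Z :: "'a \<Rightarrow> 'h::{real_normed_vector, second_countable_topology}" and T :: "'a \<Rightarrow> real"
  assumes [measurable]: "X \<in> borel_measurable M" "Z \<in> borel_measurable M" "T \<in> borel_measurable M"
    and near: "with_prob_at_least M (1 - \<eta>) (\<lambda>w. norm (X w - Z w) \<le> Q)"
    and quantile: "with_prob_at_least M (1 - \<eta>) (\<lambda>w.
      prob {v \<in> space M. norm (Z v) \<le> T w - R} \<le> 1 - \<alpha> + \<eta> \<and>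
      1 - \<alpha> - \<eta> \<le> prob {v \<in> space M. norm (Z v) \<le> T w + R})"
    and lower: "with_prob_at_least M (1 - (1 - \<alpha> - 2 * \<eta>)) (\<lambda>w. l \<le> norm (Z w))"
    and QR: "0 \<le> Q" "0 \<le> R" and \<alpha>: "0 < \<alpha>" "\<alpha> < 1" and \<eta>: "0 < \<eta>" "\<eta> < (1 - \<alpha>) / 2"
    and pos: "0 < l - (Q + R)" and \<delta>: "(Q + R) / (l - (Q + R)) \<le> \<delta>" "\<delta> \<le> 1 / 2"
  shows "1 - \<alpha> - 3 * \<eta> \<le> prob {w \<in> space M. norm (X w) \<le> (1 + \<delta>) * \<bar>T w\<bar>}"
    and "prob {w \<in> space M. norm (X w) \<le> (1 - 2 * \<delta>) * (1 + \<delta>) * \<bar>T w\<bar>} \<le> 1 - \<alpha> + 3 * \<eta>"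
proof -
  obtain EQ where EQ: "EQ \<in> sets M" "prob EQ \<le> \<eta>" "\<And>w. w \<in> space M - EQ \<Longrightarrow> norm (X w - Z w) \<le> Q"
    using with_prob_at_least_compl[OF near] by blast
  obtain ET where ET: "ET \<in> sets M" "prob ET \<le> \<eta>"
    and ET_quantile: "\<And>w. w \<in> space M - ET \<Longrightarrow>
      prob {v \<in> space M. norm (Z v) \<le> T w - R} \<le> 1 - \<alpha> + \<eta> \<and>
      1 - \<alpha> - \<eta> \<le> prob {v \<in> space M. norm (Z v) \<le> T w + R}"
    using with_prob_at_least_compl[OF quantile] by blast
  note ET_lo = ET_quantile[THEN conjunct1] and ET_hi = ET_quantile[THEN conjunct2]
  obtain EL where EL: "EL \<in> sets M" "prob EL \<le> 1 - \<alpha> - 2 * \<eta>" "\<And>w. w \<in> space M - EL \<Longrightarrow> l \<le> norm (Z w)"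
    using with_prob_at_least_compl[OF lower] by blast
  have l_le: "l \<le> s" if "1 - \<alpha> - \<eta> \<le> prob {v \<in> space M. norm (Z v) \<le> s}" for s
  proof (rule ccontr)
    assume "\<not> l \<le> s"
    then have "prob {v \<in> space M. norm (Z v) \<le> s} \<le> prob EL"
      using EL by (intro finite_measure_mono) force+
    then show False using that EL(2) \<eta> by linarith
  qed
  have good: "0 < T w" "Q + R \<le> \<delta> * T w" if "w \<in> space M - ET" for w
  proof -
    have T: "l - (Q + R) \<le> T w" using l_le[OF ET_hi[OF that]] QR by linarith
    then show "0 < T w" using pos by linarith
    have "Q + R \<le> \<delta> * (l - (Q + R))" using \<delta>(1) pos by (simp add: divide_le_eq)
    also have "0 \<le> \<delta>" using order_trans[OF _ \<delta>(1)] QR pos by auto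
    then have "\<delta> * (l - (Q + R)) \<le> \<delta> * T w" using T by (intro mult_left_mono)
    finally show "Q + R \<le> \<delta> * T w" .
  qed
  have meas: "{w \<in> space M. norm (X w) \<le> c * \<bar>T w\<bar>} \<in> sets M" for c by measurable
  have EQT: "EQ \<union> ET \<in> sets M" "prob (EQ \<union> ET) \<le> 2 * \<eta>"
    using EQ ET measure_Un_le[OF EQ(1) ET(1)] by auto
  show "1 - \<alpha> - 3 * \<eta> \<le> prob {w \<in> space M. norm (X w) \<le> (1 + \<delta>) * \<bar>T w\<bar>}"
  proof -
    have "(\<lambda>w. norm (Z w)) \<in> borel_measurable M" by measurable
    then obtain E where E: "E \<in> sets M" "prob E \<le> 1 - (1 - \<alpha> - \<eta>)"
      "\<And>w s. w \<in> space M - E \<Longrightarrow> 1 - \<alpha> - \<eta> \<le> prob {v \<in> space M. norm (Z v) \<le> s} \<Longrightarrow> norm (Z w) \<le> s"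
      by (rule upper_quantile_event[where p = "1 - \<alpha> - \<eta>"]) (use \<alpha> \<eta> in auto)
    have "prob (space M) \<le> prob {w \<in> space M. norm (X w) \<le> (1 + \<delta>) * \<bar>T w\<bar>} + (\<alpha> + 3 * \<eta>)"
    proof (rule prob_le_of_exceptional[OF sets.top meas])
      show "E \<union> (EQ \<union> ET) \<in> sets M" using E EQT by simp
      show "prob (E \<union> (EQ \<union> ET)) \<le> \<alpha> + 3 * \<eta>"
        using measure_Un_le[OF E(1) EQT(1)] E(2) EQT(2) by linarith
      fix w assume w: "w \<in> space M" "w \<notin> E \<union> (EQ \<union> ET)"
      have "norm (X w) \<le> norm (Z w) + norm (X w - Z w)" by (rule norm_triangle_sub)
      also have "\<dots> \<le> (T w + R) + Q"
        using w E(3)[OF _ ET_hi] EQ(3) by (intro add_mono) auto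
      also have "\<dots> \<le> (1 + \<delta>) * T w" using good(2)[of w] w by (simp add: algebra_simps)
      finally show "w \<in> {w \<in> space M. norm (X w) \<le> (1 + \<delta>) * \<bar>T w\<bar>}"
        using good(1)[of w] w by simp
    qed
    then show ?thesis by (simp add: prob_space)
  qed
  show "prob {w \<in> space M. norm (X w) \<le> (1 - 2 * \<delta>) * (1 + \<delta>) * \<bar>T w\<bar>} \<le> 1 - \<alpha> + 3 * \<eta>"
  proof -
    have "(\<lambda>w. norm (Z w)) \<in> borel_measurable M" by measurable
    then obtain E where E: "E \<in> sets M" "prob E \<le> 1 - \<alpha> + \<eta>"
      "\<And>w s. w \<in> space M - E \<Longrightarrow> prob {v \<in> space M. norm (Z v) \<le> s} \<le> 1 - \<alpha> + \<eta> \<Longrightarrow> s < norm (Z w)"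
      by (rule lower_quantile_event[where p = "1 - \<alpha> + \<eta>"]) (use \<alpha> \<eta> in auto)
    have "prob {w \<in> space M. norm (X w) \<le> (1 - 2 * \<delta>) * (1 + \<delta>) * \<bar>T w\<bar>} \<le> prob E + 2 * \<eta>"
    proof (rule prob_le_of_exceptional[OF meas E(1) EQT(1) _ EQT(2)])
      fix w assume w: "w \<in> {w \<in> space M. norm (X w) \<le> (1 - 2 * \<delta>) * (1 + \<delta>) * \<bar>T w\<bar>}" "w \<notin> EQ \<union> ET"
      have "norm (Z w) \<le> norm (X w) + norm (Z w - X w)" by (rule norm_triangle_sub)
      also have "\<dots> \<le> (1 - 2 * \<delta>) * (1 + \<delta>) * T w + Q"
        using w good(1)[of w] EQ(3)[of w] by (intro add_mono) (auto simp: norm_minus_commute)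
      also have "\<dots> \<le> (1 - \<delta>) * T w + Q"
        using good(1)[of w] w by (intro add_mono mult_right_mono) (auto simp: algebra_simps)
      also have "\<dots> \<le> T w - R" using good(2)[of w] w by (simp add: algebra_simps)
      finally show "w \<in> E" using E(3)[of w "T w - R"] ET_lo[of w] w by force
    qed
    then show ?thesis using E(2) by linarith
  qed
qed

lemma mem_scaled_ball_iff:
  fixes a x :: "'h::real_normed_vector"
  assumes "0 \<le> \<rho>"
  shows "(\<exists>f. x = a + c *\<^sub>R f \<and> norm f \<le> \<rho>) \<longleftrightarrow> norm (a - x) \<le> \<bar>c\<bar> * \<rho>"
proof
  assume "\<exists>f. x = a + c *\<^sub>R f \<and> norm f \<le> \<rho>"
  then show "norm (a - x) \<le> \<bar>c\<bar> * \<rho>" by (auto intro!: mult_left_mono)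
next
  assume le: "norm (a - x) \<le> \<bar>c\<bar> * \<rho>"
  show "\<exists>f. x = a + c *\<^sub>R f \<and> norm f \<le> \<rho>"
  proof (cases "c = 0")
    case True
    then show ?thesis using le assms by (intro exI[of _ 0]) auto
  next
    case False
    then have "norm ((1 / c) *\<^sub>R (x - a)) \<le> \<rho>"
      using le by (simp add: norm_minus_commute divide_le_eq mult.commute)
    then show ?thesis using False by (intro exI[of _ "(1 / c) *\<^sub>R (x - a)"]) auto
  qed
qed

text \<open>
  Both confidence sets are balls around \<open>f_hat\<close>: replacing a point of the first by its convex combination
  with the centre multiplies the radius by \<open>1 - 2 \<delta>\<close>.  The absolute value covers negative \<open>t\<close>.
\<close>

lemma mem_conf_set_iff:
  fixes eval_at :: "'a::real_normed_vector \<Rightarrow> 's \<Rightarrow> real"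
  assumes n: "0 < n" and \<delta>: "0 \<le> \<delta>"
  shows "f \<in> conf_set eval_at n d l t \<delta>
    \<longleftrightarrow> norm (sqrt (real n) *\<^sub>R (f_hat eval_at n d l - f)) \<le> (1 + \<delta>) * \<bar>t\<bar>"
    and "\<delta> \<le> 1 / 2 \<Longrightarrow> f \<in> (\<lambda>g. (2 * \<delta>) *\<^sub>R f_hat eval_at n d l + (1 - 2 * \<delta>) *\<^sub>R g) ` conf_set eval_at n d l t \<delta>
    \<longleftrightarrow> norm (sqrt (real n) *\<^sub>R (f_hat eval_at n d l - f)) \<le> (1 - 2 * \<delta>) * (1 + \<delta>) * \<bar>t\<bar>"
proof -
  let ?a = "f_hat eval_at n d l"
  have scale: "norm y \<le> \<bar>b * (t / sqrt (real n))\<bar> * (1 + \<delta>)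
      \<longleftrightarrow> norm (sqrt (real n) *\<^sub>R y) \<le> b * (1 + \<delta>) * \<bar>t\<bar>" if "0 \<le> b" for b and y :: 'a
    using n that by (simp add: abs_mult field_simps)
  have "f \<in> conf_set eval_at n d l t \<delta> \<longleftrightarrow> (\<exists>g. f = ?a + (t / sqrt (real n)) *\<^sub>R g \<and> norm g \<le> 1 + \<delta>)"
    by (auto simp: conf_set_def)
  then show "f \<in> conf_set eval_at n d l t \<delta>
    \<longleftrightarrow> norm (sqrt (real n) *\<^sub>R (?a - f)) \<le> (1 + \<delta>) * \<bar>t\<bar>"
    using mem_scaled_ball_iff[of "1 + \<delta>" f ?a] scale[of 1] \<delta> by simp
  have "(2 * \<delta>) *\<^sub>R ?a + (1 - 2 * \<delta>) *\<^sub>R (?a + (t / sqrt (real n)) *\<^sub>R g)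
      = ?a + ((1 - 2 * \<delta>) * (t / sqrt (real n))) *\<^sub>R g" for g
    by (simp add: algebra_simps)
  then have "f \<in> (\<lambda>g. (2 * \<delta>) *\<^sub>R ?a + (1 - 2 * \<delta>) *\<^sub>R g) ` conf_set eval_at n d l t \<delta>
     \<longleftrightarrow> (\<exists>g. f = ?a + ((1 - 2 * \<delta>) * (t / sqrt (real n))) *\<^sub>R g \<and> norm g \<le> 1 + \<delta>)"
    unfolding conf_set_def by (auto simp: image_iff)
  then show "f \<in> (\<lambda>g. (2 * \<delta>) *\<^sub>R ?a + (1 - 2 * \<delta>) *\<^sub>R g) ` conf_set eval_at n d l t \<delta>
    \<longleftrightarrow> norm (sqrt (real n) *\<^sub>R (?a - f)) \<le> (1 - 2 * \<delta>) * (1 + \<delta>) * \<bar>t\<bar>" if "\<delta> \<le> 1 / 2"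
    using mem_scaled_ball_iff[of "1 + \<delta>" f ?a] scale[of "1 - 2 * \<delta>"] \<delta> that by simp
qed

section \<open>Bootstrap validity for kernel ridge regression\<close>

lemma (in krr_setting) data_measurable:
  assumes "i < n" shows "D i \<in> borel_measurable M"
  using data_indep assms by (auto simp: indep_vars_def)

lemma (in krr_setting) finite_measure_subalgebra_data:
  "finite_measure_subalgebra M (data_sigma M n D)"
proof (intro finite_measure_subalgebra.intro finite_measure_subalgebra_axioms.intro)
  show "finite_measure M" by (rule finite_measure_axioms)
  have "(\<lambda>w. \<lambda>i\<in>{..<n}. D i w) \<in> measurable M (\<Pi>\<^sub>M i\<in>{..<n}. borel)"
    using data_measurable by (intro measurable_restrict) auto
  then show "subalgebra M (data_sigma M n D)"
    unfolding subalgebra_def data_sigma_def by (simp add: sets_image_in_sets)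
qed

lemma modulus_imp_continuous:
  fixes F :: "'h::real_normed_vector \<Rightarrow> real"
  assumes \<psi>: "modulus_of_continuity \<psi>" and F: "\<And>u v. \<bar>F u - F v\<bar> \<le> \<psi> (norm (u - v))"
  shows "continuous_on UNIV F"
  unfolding continuous_on_iff
proof (intro ballI allI impI)
  fix x :: 'h and e :: real assume "0 < e"
  have "(\<psi> \<longlongrightarrow> 0) (at_right 0)" using \<psi> by (simp add: modulus_of_continuity_def)
  then have "eventually (\<lambda>r. \<psi> r < e) (at_right 0)" using \<open>0 < e\<close> by (rule order_tendstoD)
  then obtain b where b: "0 < b" "\<And>r. 0 < r \<Longrightarrow> r < b \<Longrightarrow> \<psi> r < e"
    by (auto simp: eventually_at_right_field)
  have "dist (F y) (F x) < e" if "dist y x < b" for y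
  proof (cases "y = x")
    case False
    then have "\<psi> (norm (y - x)) < e" using b(2) that by (simp add: dist_norm)
    then show ?thesis using F[of y x] by (simp add: dist_norm)
  qed (use \<open>0 < e\<close> in simp)
  then show "\<exists>d>0. \<forall>y\<in>UNIV. dist y x < d \<longrightarrow> dist (F y) (F x) < e" using b(1) by blast
qed

lemma modulus_measurable:
  fixes F :: "'h::real_normed_vector \<Rightarrow> real"
  assumes "modulus_of_continuity \<psi>" "\<And>u v. \<bar>F u - F v\<bar> \<le> \<psi> (norm (u - v))"
  shows "F \<in> borel_measurable borel"
  using assms by (intro borel_measurable_continuous_onI modulus_imp_continuous)

lemma oscillation_le_modulus:
  fixes F :: "'h::real_normed_vector \<Rightarrow> real"
  assumes \<psi>: "modulus_of_continuity \<psi>" and F: "\<And>u v. \<bar>F u - F v\<bar> \<le> \<psi> (norm (u - v))"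
    and r: "0 \<le> r"
  shows "\<forall>u v. norm (u - v) \<le> r \<longrightarrow> \<bar>F u - F v\<bar> \<le> \<psi> r"
proof (intro allI impI)
  fix u v :: 'h assume uv: "norm (u - v) \<le> r"
  have "mono_on {0..} \<psi>" using \<psi> by (simp add: modulus_of_continuity_def)
  then have "\<psi> (norm (u - v)) \<le> \<psi> r" by (rule mono_onD) (use r uv in auto)
  then show "\<bar>F u - F v\<bar> \<le> \<psi> r" using F[of u v] by linarith
qed

theorem corollary3:
  fixes M :: "'w measure"
    and k :: "'s::polish_space \<Rightarrow> 's \<Rightarrow> real"
    and eval_at :: "'h::{real_inner, banach, second_countable_topology} \<Rightarrow> 's \<Rightarrow> real"
    and P :: "('s \<times> real) measure"
    and f0 :: "'s \<Rightarrow> real"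
    and n :: nat
    and D :: "nat \<Rightarrow> 'w \<Rightarrow> 's \<times> real"
    and h :: "nat \<Rightarrow> nat \<Rightarrow> 'w \<Rightarrow> real"
    and \<kappa> \<sigma>_up \<sigma>_lo lam \<eta> Q R :: real
    and L :: "real \<Rightarrow> real \<Rightarrow> real"
    and Z Z' fh_err B :: "'w \<Rightarrow> 'h"
    and KB :: "'w \<Rightarrow> 'h measure"
  assumes setting: "krr_setting M k eval_at P f0 n D h \<kappa> \<sigma>_up \<sigma>_lo"
    and bias_bounded:
      "\<exists>C. \<forall>l>0. \<forall>x. \<bar>f0 x - eval_at (f_pseudo eval_at P l) x\<bar> \<le> C"
    and lam: "lam > 0"
    and eta: "0 < \<eta>" "\<eta> < 1"
    and fh_err_def: "fh_err =
      (\<lambda>w. sqrt (real n) *\<^sub>R (f_hat eval_at n (\<lambda>i. D i w) lam - f_pseudo eval_at P lam))"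
    and B_def: "B = (\<lambda>w. bootstrap k eval_at n (\<lambda>i. D i w) lam (\<lambda>i j. h i j w))"
    and KB: "regular_cond_distr M (data_sigma M n D) borel B KB"
    and Z_measurable: "Z \<in> borel_measurable M"
    and Z_gaussian: "centered_gaussian (distr M borel Z)"
    and Z_cov: "has_covariance (distr M borel Z) (Sigma_op k eval_at P lam)"
    and Z_approx: "with_prob_at_least M (1 - \<eta>) (\<lambda>w. norm (fh_err w - Z w) \<le> Q)"
    and Z'_gaussian: "\<exists>K. regular_cond_distr M (data_sigma M n D) borel Z' K \<and>
      (AE w in M. centered_gaussian (K w) \<and> has_covariance (K w) (Sigma_op k eval_at P lam))"
    and Z'_approx: "with_prob_at_least M (1 - \<eta>)
      (\<lambda>w. real_cond_exp M (data_sigma M n D)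
         (indicator {w' \<in> space M. norm (B w' - Z' w') \<le> R}) w \<ge> 1 - \<eta>)"
    and L_mono: "strict_mono_on {0<..<1} (L lam)"
    and Z_lower: "\<forall>\<eta>'\<in>{0<..<1}. with_prob_at_least M (1 - \<eta>') (\<lambda>w. norm (Z w) \<ge> L lam \<eta>')"
  shows
    "(\<forall>\<alpha> \<delta> t_hat.
        0 < \<alpha> \<and> \<alpha> < 1 \<and>
        t_hat \<in> borel_measurable (data_sigma M n D) \<and>
        (AE w in M. measure (KB w) {u. norm u > t_hat w} = \<alpha>) \<and>
        \<eta> < min \<alpha> ((1 - \<alpha>) / 2) \<and>
        L lam (1 - \<alpha> - 2 * \<eta>) - (Q + R) > 0 \<and>
        \<delta> \<ge> (Q + R) / (L lam (1 - \<alpha> - 2 * \<eta>) - (Q + R)) \<and>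
        \<delta> \<le> 1 / 2
        \<longrightarrow>
        measure M {w \<in> space M.
            f_pseudo eval_at P lam \<in> conf_set eval_at n (\<lambda>i. D i w) lam (t_hat w) \<delta>}
          \<ge> 1 - \<alpha> - 3 * \<eta> \<and>
        measure M {w \<in> space M.
            f_pseudo eval_at P lam \<in>
              (\<lambda>g. (2 * \<delta>) *\<^sub>R f_hat eval_at n (\<lambda>i. D i w) lam + (1 - 2 * \<delta>) *\<^sub>R g) `
                conf_set eval_at n (\<lambda>i. D i w) lam (t_hat w) \<delta>}
          \<le> 1 - \<alpha> + 3 * \<eta>)
     \<and>
     (\<forall>(F :: 'h \<Rightarrow> real) \<psi>.
        modulus_of_continuity \<psi> \<and> (\<forall>u v. \<bar>F u - F v\<bar> \<le> \<psi> (norm (u - v)))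
        \<longrightarrow>
        (\<forall>a :: real \<Rightarrow> real.
           (\<forall>r>0. 0 \<le> a r \<and> a r \<le> 1) \<and> mono_on {0<..} a \<and>
           (a \<longlongrightarrow> 0) (at_right 0) \<and> a 0 = 0 \<and>
           (\<forall>r>0. (SUP t. measure M {w \<in> space M. \<bar>F (Z w) - t\<bar> \<le> r}) \<le> a r)
           \<longrightarrow>
           with_prob_at_least M (1 - \<eta>) (\<lambda>w.
             (SUP t. \<bar>measure M {w' \<in> space M. F (fh_err w') \<le> t} - measure (KB w) {u. F u \<le> t}\<bar>)
               \<le> a (\<psi> Q) + a (\<psi> R) + 2 * \<eta>)) \<and>
        with_prob_at_least M (1 - \<eta>) (\<lambda>w.
          (SUP t. \<bar>measure M {w' \<in> space M. F (fh_err w') \<le> t} - measure (KB w) {u. F u \<le> t}\<bar>)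
            \<le> 2 * (SUP t. measure (KB w) {u. \<bar>F u - t\<bar> \<le> 2 * \<psi> (Q + R)}) + 4 * \<eta>))"
proof -
  interpret krr_setting M k eval_at P f0 n D h \<kappa> \<sigma>_up \<sigma>_lo by (rule setting)
  let ?G = "data_sigma M n D"
  have sub: "finite_measure_subalgebra M ?G" by (rule finite_measure_subalgebra_data)
  interpret sub: finite_measure_subalgebra M ?G by (rule sub)
  have [measurable]: "(\<lambda>w. f_hat eval_at n (\<lambda>i. D i w) lam) \<in> borel_measurable M"
    by (rule measurable_f_hat[OF rkhs kernel_measurable kernel_bounded data_measurable lam])
  have fh_err[measurable]: "fh_err \<in> borel_measurable M"
    unfolding fh_err_def by measurable
  note Zm[measurable] = Z_measurable
  have space_G: "space ?G = space M" using sub.subalg by (simp add: subalgebra_def)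
  have KB_prob: "prob_space (KB w)" "sets (KB w) = sets borel" "space (KB w) = UNIV" if "w \<in> space M" for w
    using regular_cond_distr_prob_space[OF KB] that sets_eq_imp_space_eq[of "KB w" borel] by (auto simp: space_G)
  have Q: "0 \<le> Q"
    using with_prob_at_least_pos_witness[OF Z_approx] eta by (auto intro: order_trans[OF norm_ge_zero])
  have R: "0 \<le> R"
  proof (rule ccontr)
    assume "\<not> 0 \<le> R"
    then have "\<not> norm u \<le> R" for u :: 'h using norm_ge_zero[of u] by linarith
    then have empty: "{w' \<in> space M. norm (B w' - Z' w') \<le> R} = {}" by blast
    have zero: "(indicator {} :: 'w \<Rightarrow> real) = (\<lambda>_. 0)" by (simp add: fun_eq_iff)
    have "AE w in M. real_cond_exp M ?G (\<lambda>_. 0) w = 0"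
      by (rule sub.real_cond_exp_F_meas) auto
    then have "AE w in M. 1 - \<eta> \<le> real_cond_exp M ?G (indicator {w' \<in> space M. norm (B w' - Z' w') \<le> R}) w \<longrightarrow> False"
      unfolding empty zero by eventually_elim (use eta in auto)
    from with_prob_at_least_pos_witness[OF with_prob_at_least_AE_mono[OF Z'_approx this]] eta
    show False by simp
  qed
  obtain K where K: "regular_cond_distr M ?G borel Z' K"
    and K_gaussian: "AE w in M. centered_gaussian (K w) \<and> has_covariance (K w) (Sigma_op k eval_at P lam)"
    using Z'_gaussian by blast
  \<comment> \<open>The conditional law of \<open>Z'\<close> does not depend on the data.\<close>
  have K_eq: "AE w in M. K w = distr M borel Z"
    using K_gaussian by eventually_elim (auto intro!: centered_gaussian_eqI Z_gaussian Z_cov)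
  have conditional: "with_prob_at_least M (1 - \<eta>) (\<lambda>w. w \<in> space M \<and> (\<forall>t.
      measure (KB w) {u. F u \<le> t} \<le> prob {w \<in> space M. F (Z w) \<le> t + s} + \<eta> \<and>
      prob {w \<in> space M. F (Z w) \<le> t - s} \<le> measure (KB w) {u. F u \<le> t} + \<eta>))"
    if F[measurable]: "F \<in> borel_measurable borel"
      and near: "\<forall>u v. norm (u - v) \<le> R \<longrightarrow> \<bar>F u - F v\<bar> \<le> s" for F :: "'h \<Rightarrow> real" and s
  proof (rule with_prob_at_least_AE_mono[OF Z'_approx])
    have Z_law: "measure (distr M borel Z) {u. F u \<le> x} = prob {w \<in> space M. F (Z w) \<le> x}" for x
      by (subst measure_distr) (auto intro!: arg_cong[of _ _ prob])
    show "AE w in M. 1 - \<eta> \<le> real_cond_exp M ?G (indicator {w' \<in> space M. norm (B w' - Z' w') \<le> R}) w \<longrightarrow>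
        w \<in> space M \<and> (\<forall>t.
      measure (KB w) {u. F u \<le> t} \<le> prob {w \<in> space M. F (Z w) \<le> t + s} + \<eta> \<and>
      prob {w \<in> space M. F (Z w) \<le> t - s} \<le> measure (KB w) {u. F u \<le> t} + \<eta>)"
      using cond_cdf_sandwich_of_coupling[OF sub KB K F near, where \<eta> = \<eta>] K_eq AE_space
      by eventually_elim (simp add: Z_law)
  qed
  show ?thesis
  proof ((rule conjI; intro allI impI), goal_cases)
    case (1 \<alpha> \<delta> t_hat)
    then have \<alpha>: "0 < \<alpha>" "\<alpha> < 1" and t_hat: "t_hat \<in> borel_measurable ?G"
      and quantile: "AE w in M. measure (KB w) {u. norm u > t_hat w} = \<alpha>"
      and \<eta>\<alpha>: "\<eta> < min \<alpha> ((1 - \<alpha>) / 2)" and pos: "L lam (1 - \<alpha> - 2 * \<eta>) - (Q + R) > 0"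
      and \<delta>: "\<delta> \<ge> (Q + R) / (L lam (1 - \<alpha> - 2 * \<eta>) - (Q + R))" "\<delta> \<le> 1 / 2"
      by auto
    have tm: "t_hat \<in> borel_measurable M" by (rule measurable_from_subalg[OF sub.subalg t_hat])
    have "with_prob_at_least M (1 - \<eta>) (\<lambda>w.
        prob {v \<in> space M. norm (Z v) \<le> t_hat w - R} \<le> 1 - \<alpha> + \<eta> \<and>
        1 - \<alpha> - \<eta> \<le> prob {v \<in> space M. norm (Z v) \<le> t_hat w + R})"
    proof (rule with_prob_at_least_AE_mono[OF conditional[of norm R]])
      show "\<forall>u v :: 'h. norm (u - v) \<le> R \<longrightarrow> \<bar>norm u - norm v\<bar> \<le> R"
        using norm_triangle_ineq3 order_trans by blast
      have compl: "measure (KB w) {u. norm u \<le> t_hat w} = 1 - measure (KB w) {u. norm u > t_hat w}"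
        if "w \<in> space M" for w
      proof -
        interpret KB: prob_space "KB w" by (rule KB_prob[OF that])
        note [measurable_cong] = KB_prob(2)[OF that]
        have "{u :: 'h. norm u \<le> t_hat w} = space (KB w) - {u. norm u > t_hat w}"
          by (auto simp: KB_prob(3)[OF that])
        also have "measure (KB w) \<dots> = 1 - measure (KB w) {u. norm u > t_hat w}"
          by (rule KB.prob_compl) measurable
        finally show ?thesis .
      qed
      show "AE w in M. (w \<in> space M \<and> (\<forall>t. measure (KB w) {u. norm u \<le> t} \<le> prob {w \<in> space M. norm (Z w) \<le> t + R} + \<eta> \<and>
          prob {w \<in> space M. norm (Z w) \<le> t - R} \<le> measure (KB w) {u. norm u \<le> t} + \<eta>)) \<longrightarrow>
          prob {v \<in> space M. norm (Z v) \<le> t_hat w - R} \<le> 1 - \<alpha> + \<eta> \<and>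
          1 - \<alpha> - \<eta> \<le> prob {v \<in> space M. norm (Z v) \<le> t_hat w + R}"
        using quantile
      proof (eventually_elim, intro impI, elim conjE)
        fix w
        assume "measure (KB w) {u. norm u > t_hat w} = \<alpha>" and w: "w \<in> space M"
          and sandwich: "\<forall>t. measure (KB w) {u. norm u \<le> t} \<le> prob {w \<in> space M. norm (Z w) \<le> t + R} + \<eta> \<and>
            prob {w \<in> space M. norm (Z w) \<le> t - R} \<le> measure (KB w) {u. norm u \<le> t} + \<eta>"
        then show "prob {v \<in> space M. norm (Z v) \<le> t_hat w - R} \<le> 1 - \<alpha> + \<eta> \<and>
            1 - \<alpha> - \<eta> \<le> prob {v \<in> space M. norm (Z v) \<le> t_hat w + R}"
          using sandwich[rule_format, of "t_hat w"] compl[OF w] by (intro conjI) linarith+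
      qed
    qed measurable
    moreover have "with_prob_at_least M (1 - (1 - \<alpha> - 2 * \<eta>)) (\<lambda>w. L lam (1 - \<alpha> - 2 * \<eta>) \<le> norm (Z w))"
      by (rule Z_lower[rule_format]) (use \<alpha> \<eta>\<alpha> eta in auto)
    ultimately have cover:
      "1 - \<alpha> - 3 * \<eta> \<le> prob {w \<in> space M. norm (fh_err w) \<le> (1 + \<delta>) * \<bar>t_hat w\<bar>}"
      "prob {w \<in> space M. norm (fh_err w) \<le> (1 - 2 * \<delta>) * (1 + \<delta>) * \<bar>t_hat w\<bar>} \<le> 1 - \<alpha> + 3 * \<eta>"
      using coverage_of_coupling[OF fh_err Zm tm Z_approx _ _ Q R \<alpha> eta(1) _ pos \<delta>] \<eta>\<alpha> by auto
    have "0 \<le> \<delta>"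
      using order_trans[OF divide_nonneg_pos \<delta>(1)] Q R pos by simp
    note mem = mem_conf_set_iff(1)[OF n_pos this] mem_conf_set_iff(2)[OF n_pos this \<delta>(2)]
    show ?case
      unfolding mem using cover by (simp add: fh_err_def)
  next
    case (2 F \<psi>)
    then have \<psi>: "modulus_of_continuity \<psi>" and F: "\<And>u v. \<bar>F u - F v\<bar> \<le> \<psi> (norm (u - v))" by auto
    note Fm[measurable] = modulus_measurable[OF \<psi> F]
    note F_near = oscillation_le_modulus[OF \<psi> F]
    show ?case
    proof (rule conjI, intro allI impI)
      fix a :: "real \<Rightarrow> real"
      assume "(\<forall>r>0. 0 \<le> a r \<and> a r \<le> 1) \<and> mono_on {0<..} a \<and>
             (a \<longlongrightarrow> 0) (at_right 0) \<and> a 0 = 0 \<and>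
             (\<forall>r>0. (SUP t. prob {w \<in> space M. \<bar>F (Z w) - t\<bar> \<le> r}) \<le> a r)"
      then have a_lim: "(a \<longlongrightarrow> 0) (at_right 0)" and a0: "a 0 = 0"
        and a_conc: "\<And>r. 0 < r \<Longrightarrow> (SUP t. prob {w \<in> space M. \<bar>F (Z w) - t\<bar> \<le> r}) \<le> a r"
        by auto
      have conc_pos: "prob {w \<in> space M. \<bar>F (Z w) - t\<bar> \<le> r} \<le> a r" if "0 < r" for t r
      proof -
        have "bdd_above (range (\<lambda>t. prob {w \<in> space M. \<bar>F (Z w) - t\<bar> \<le> r}))"
          by (rule bdd_aboveI2[of _ _ 1]) simp
        from cSUP_upper[OF UNIV_I this, of t] a_conc[OF that] show ?thesis by linarith
      qed
      \<comment> \<open>\<open>\<psi> Q\<close> or \<open>\<psi> R\<close> may be \<open>0\<close>; there the bound follows from the decay of \<open>a\<close> at \<open>0\<close>.\<close>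
      have conc: "prob {w \<in> space M. \<bar>F (Z w) - t\<bar> \<le> r} \<le> a r" if "0 \<le> r" for t r
      proof (cases "r = 0")
        case True
        have "prob {w \<in> space M. \<bar>F (Z w) - t\<bar> \<le> 0} \<le> a r" if "0 < r" for r
          using that by (intro order_trans[OF finite_measure_mono conc_pos[OF that, of t]]) auto
        then have "prob {w \<in> space M. \<bar>F (Z w) - t\<bar> \<le> 0} \<le> 0"
          using a_lim by (intro tendsto_lowerbound[of a 0 "at_right 0"])
            (auto simp: eventually_at_right_field intro!: exI[of _ 1])
        then show ?thesis by (simp add: True a0)
      qed (use that conc_pos in auto)
      have \<psi>0: "0 \<le> \<psi> r" if "0 \<le> r" for r using \<psi> that by (simp add: modulus_of_continuity_def)
      show "with_prob_at_least M (1 - \<eta>) (\<lambda>w.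
               (SUP t. \<bar>prob {w' \<in> space M. F (fh_err w') \<le> t} - measure (KB w) {u. F u \<le> t}\<bar>)
                 \<le> a (\<psi> Q) + a (\<psi> R) + 2 * \<eta>)"
      proof (rule with_prob_at_least_AE_mono[OF conditional[OF Fm F_near[OF R]]],
          intro AE_I2 impI cSUP_least UNIV_not_empty, elim conjE)
        fix w t
        assume "\<forall>t. measure (KB w) {u. F u \<le> t} \<le> prob {w \<in> space M. F (Z w) \<le> t + \<psi> R} + \<eta> \<and>
          prob {w \<in> space M. F (Z w) \<le> t - \<psi> R} \<le> measure (KB w) {u. F u \<le> t} + \<eta>"
        then have "measure (KB w) {u. F u \<le> t} \<le> prob {w \<in> space M. F (Z w) \<le> t + \<psi> R} + \<eta>"
          "prob {w \<in> space M. F (Z w) \<le> t - \<psi> R} \<le> measure (KB w) {u. F u \<le> t} + \<eta>" by auto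
        moreover have "prob {w \<in> space M. F (fh_err w) \<le> t} \<le> prob {w \<in> space M. F (Z w) \<le> t + \<psi> Q} + \<eta>"
          "prob {w \<in> space M. F (Z w) \<le> t - \<psi> Q} \<le> prob {w \<in> space M. F (fh_err w) \<le> t} + \<eta>"
          by (rule cdf_sandwich_of_coupling[OF fh_err Zm Fm Z_approx F_near[OF Q]])+
        moreover have "prob {w \<in> space M. F (Z w) \<le> t + \<psi> r} \<le> prob {w \<in> space M. F (Z w) \<le> t} + a (\<psi> r)"
          "prob {w \<in> space M. F (Z w) \<le> t} \<le> prob {w \<in> space M. F (Z w) \<le> t - \<psi> r} + a (\<psi> r)"
          if "0 \<le> r" for r
          using cdf_increment_le_concentration[of "\<lambda>w. F (Z w)" t "\<psi> r"] conc[OF \<psi>0[OF that], of t] by auto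
        from this[OF Q] this[OF R] calculation
        show "\<bar>prob {w' \<in> space M. F (fh_err w') \<le> t} - measure (KB w) {u. F u \<le> t}\<bar> \<le> a (\<psi> Q) + a (\<psi> R) + 2 * \<eta>"
          unfolding abs_le_iff by linarith
      qed
    next
      let ?r = "2 * \<psi> (Q + R)"
      have \<psi>_mono: "mono_on {0..} \<psi>" using \<psi> by (simp add: modulus_of_continuity_def)
      have "\<psi> Q \<le> \<psi> (Q + R)" "\<psi> R \<le> \<psi> (Q + R)"
        by (rule mono_onD[OF \<psi>_mono]; use Q R in simp)+
      then have r: "\<psi> Q + \<psi> R \<le> ?r" by linarith
      show "with_prob_at_least M (1 - \<eta>) (\<lambda>w.
            (SUP t. \<bar>prob {w' \<in> space M. F (fh_err w') \<le> t} - measure (KB w) {u. F u \<le> t}\<bar>)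
              \<le> 2 * (SUP t. measure (KB w) {u. \<bar>F u - t\<bar> \<le> 2 * \<psi> (Q + R)}) + 4 * \<eta>)"
      proof (rule with_prob_at_least_AE_mono[OF conditional[OF Fm F_near[OF R]]],
          intro AE_I2 impI cSUP_least UNIV_not_empty, elim conjE)
        fix w t
        assume w: "w \<in> space M" and "\<forall>t. measure (KB w) {u. F u \<le> t} \<le> prob {w \<in> space M. F (Z w) \<le> t + \<psi> R} + \<eta> \<and>
          prob {w \<in> space M. F (Z w) \<le> t - \<psi> R} \<le> measure (KB w) {u. F u \<le> t} + \<eta>"
        then have KB_le: "measure (KB w) {u. F u \<le> x} \<le> prob {w \<in> space M. F (Z w) \<le> x + \<psi> R} + \<eta>"
          and le_KB: "prob {w \<in> space M. F (Z w) \<le> x - \<psi> R} \<le> measure (KB w) {u. F u \<le> x} + \<eta>" for x by auto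
        have X_le: "prob {w \<in> space M. F (fh_err w) \<le> x} \<le> prob {w \<in> space M. F (Z w) \<le> x + \<psi> Q} + \<eta>"
          and le_X: "prob {w \<in> space M. F (Z w) \<le> x - \<psi> Q} \<le> prob {w \<in> space M. F (fh_err w) \<le> x} + \<eta>" for x
          by (rule cdf_sandwich_of_coupling[OF fh_err Zm Fm Z_approx F_near[OF Q]])+
        interpret KB: prob_space "KB w" by (rule KB_prob[OF w])
        note [measurable_cong] = KB_prob(2)[OF w]
        define c where "c = (SUP t. measure (KB w) {u. \<bar>F u - t\<bar> \<le> ?r})"
        have "bdd_above (range (\<lambda>t. measure (KB w) {u. \<bar>F u - t\<bar> \<le> ?r}))"
          by (rule bdd_aboveI2[of _ _ 1]) simp
        from cSUP_upper[OF UNIV_I this, of t]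
        have conc: "measure (KB w) {u. \<bar>F u - t\<bar> \<le> ?r} \<le> c" by (simp only: c_def)
        have c0: "0 \<le> c" using order_trans[OF measure_nonneg conc] .
        have mono: "measure (KB w) {u. F u \<le> x} \<le> measure (KB w) {u. F u \<le> y}" if "x \<le> y" for x y
          using that by (intro KB.finite_measure_mono) auto
        have incr: "measure (KB w) {u. F u \<le> t + ?r} \<le> measure (KB w) {u. F u \<le> t} + c"
          "measure (KB w) {u. F u \<le> t} \<le> measure (KB w) {u. F u \<le> t - ?r} + c"
          using KB.cdf_increment_le_concentration[of F t ?r] conc by (auto simp: KB_prob(3)[OF w])
        \<comment> \<open>Both sandwiches are chained, for a total shift of \<open>\<psi> Q + \<psi> R\<close> at a cost of \<open>2 * \<eta>\<close>.\<close>
        have "prob {w' \<in> space M. F (fh_err w') \<le> t} \<le> measure (KB w) {u. F u \<le> t} + c + 2 * \<eta>"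
          using X_le[of t] le_KB[of "t + \<psi> Q + \<psi> R"] mono[of "t + \<psi> Q + \<psi> R" "t + ?r"] r incr(1) by simp
        moreover have "measure (KB w) {u. F u \<le> t} \<le> prob {w' \<in> space M. F (fh_err w') \<le> t} + c + 2 * \<eta>"
          using le_X[of t] KB_le[of "t - \<psi> Q - \<psi> R"] mono[of "t - ?r" "t - \<psi> Q - \<psi> R"] r incr(2) by simp
        ultimately show "\<bar>prob {w' \<in> space M. F (fh_err w') \<le> t} - measure (KB w) {u. F u \<le> t}\<bar>
            \<le> 2 * (SUP t. measure (KB w) {u. \<bar>F u - t\<bar> \<le> 2 * \<psi> (Q + R)}) + 4 * \<eta>"
          unfolding c_def[symmetric] using c0 eta by (simp add: abs_le_iff)
      qed
    qed
  qed
qed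

end
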